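(* Let $\lambda$ be a partition with 2-core $\bar{\lambda}$ and 2-quotient $(\mu,\nu)$. Then $$\mathrm{He}_{\lambda}(x)=x^{|\bar{\lambda}|}\,R_{\lambda}(x^2)$$ for a monic polynomial $R_\lambda$ of degree $|\mu|+|\nu|$ whose constant coefficient is non-zero and equals $$R_{\lambda}(0)=(-1)^{h_{\lambda}}\frac{H_{\mathrm{odd}}(\lambda)}{H(\bar{\lambda})},\qquad h_{\lambda}=\mathrm{ht}_2(\lambda/\bar{\lambda})+\frac{|\lambda|-|\bar{\lambda}|}{2}.$$
   Context: A partition is a vector $\lambda=(\lambda_1,\dots,\lambda_{\ell(\lambda)})$ of integers with $\lambda_1\ge\dots\ge\lambda_{\ell(\lambda)}>0$; $|\lambda|=\sum_i\lambda_i$ and $\ell(\lambda)$ is its length; $\emptyset$ is the empty partition. The degree vector is $n_\lambda=(n_1,\dots,n_{\ell(\lambda)})$ with $n_i=\lambda_i+\ell(\lambda)-i$, and $\Delta(n_\lambda)=\prod_{i<j}(n_j-n_i)$. The monic Hermite polynomials are $\mathrm{He}_0=1$, $\mathrm{He}_1=x$, $\mathrm{He}_n(x)=x\mathrm{He}_{n-1}(x)-(n-1)\mathrm{He}_{n-2}(x)$ for $n\ge2$. The Wronskian Hermite polynomial is $\mathrm{He}_\lambda=\mathrm{Wr}[\mathrm{He}_{n_1},\dots,\mathrm{He}_{n_{\ell(\lambda)}}]/\Delta(n_\lambda)$ (and $\mathrm{He}_\emptyset=1$). Maya diagrams and 2-core/2-quotient: a Maya diagram is a set $M\subset\mathbb{Z}$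 containing all sufficiently negative integers and only finitely many non-negative integers; its partition $\lambda(M)$ has as parts the positive values among $\#\{n\in\mathbb{Z}\setminus M: n<m\}$, $m\in M$, in non-increasing order. For a partition $\lambda$ let $M_\lambda=\{n<0\}\cup\{n_1,\dots,n_{\ell(\lambda)}\}$ and $M_\lambda+t=\{m+t:m\in M_\lambda\}$ for $t\ge0$. For partitions $\mu,\nu$ and $k\in\mathbb{Z}$ pick $s,s'\ge0$ with $\ell(\nu)+s'-\ell(\mu)-s=k$, put $M=\{2m:m\in M_\mu+s\}\cup\{2m+1:m\in M_\nu+s'\}$ and $\Phi(\mu,\nu,k)=\lambda(M)$ (independent of the choice of $s,s'$). Every partition $\lambda$ is uniquely $\lambda=\Phi(\mu,\nu,k)$ with $k\ge0$; $(\mu,\nu)$ is its 2-quotient and $\bar\lambda=(k,k-1,\dots,1)$ ($\bar\lambda=\emptyset$ if $k=0$) its 2-core. Equivalently, $\bar\lambda$ is obtained from $\lambda$ by repeatedly removing dominoes ($1\times2$ or $2\times1$ rectangles of boxes) from the Young diagram, keeping a Young diagram after each removal, until no removal is possible; $|\lambda|=|\bar\lambda|+2(|\mu|+|\nu|)$. $\mathrm{ht}_2(\lambda/\bar\lambda)$ is the number of vertical dominoes removed in such a sequence of removals from $\lambda$ to $\bar\lambda$ (its parity is independent of the sequence). For a box $(i,j)$ of the Young diagram, its hook length is the number of boxes to its right in row $i$ plus the number below it in column $j$ plus one; $H(\lambda)$ is the product of all hook lengths of $\lambda$ and $H_{\mathrm{odd}}(\lambda)$ the product of the odd hook lengths.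 *)

theory Defs
  imports "HOL-Combinatorics.Permutations" "HOL-Computational_Algebra.Polynomial"
          "HOL-Library.Multiset"
begin

(* Partitions are lists of positive naturals in non-increasing order;
   index i (0-based) corresponds to lambda_{i+1}. *)
definition is_partition :: "nat list \<Rightarrow> bool" where
  "is_partition lam \<longleftrightarrow> sorted_wrt (\<ge>) lam \<and> (\<forall>x\<in>set lam. 0 < x)"

(* degree vector n_i = lambda_i + l - i (1-based), here 0-based index i *)
definition degvec :: "nat list \<Rightarrow> nat list" where
  "degvec lam = map (\<lambda>i. lam ! i + length lam - 1 - i) [0..<length lam]"

definition Vandermonde_Delta :: "nat list \<Rightarrow> int" where
  "Vandermonde_Delta ns =
     (\<Prod>j<length ns. \<Prod>i<j. int (ns ! j) - int (ns ! i))"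

fun Herm :: "nat \<Rightarrow> real poly" where
  "Herm 0 = 1"
| "Herm (Suc 0) = [:0, 1:]"
| "Herm (Suc (Suc n)) = [:0, 1:] * Herm (Suc n) - smult (real (Suc n)) (Herm n)"

definition leibniz_det :: "nat \<Rightarrow> (nat \<Rightarrow> nat \<Rightarrow> 'a::comm_ring_1) \<Rightarrow> 'a" where
  "leibniz_det n M = (\<Sum>p | p permutes {..<n}. of_int (sign p) * (\<Prod>i<n. M i (p i)))"

definition Wronskian :: "real poly list \<Rightarrow> real poly" where
  "Wronskian fs = leibniz_det (length fs) (\<lambda>i j. (pderiv ^^ i) (fs ! j))"

definition WHermite :: "nat list \<Rightarrow> real poly" where
  "WHermite lam = (if lam = [] then 1 else
     smult (1 / real_of_int (Vandermonde_Delta (degvec lam)))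
       (Wronskian (map Herm (degvec lam))))"

definition maya :: "nat list \<Rightarrow> int set" where
  "maya lam = {n. n < 0} \<union> int ` set (degvec lam)"

definition maya_shift :: "int set \<Rightarrow> int \<Rightarrow> int set" where
  "maya_shift M t = (\<lambda>m. m + t) ` M"

definition maya_partition :: "int set \<Rightarrow> nat list" where
  "maya_partition M =
     (let f = (\<lambda>m. card {n. n \<notin> M \<and> n < m})
      in rev (sorted_list_of_multiset (image_mset f (mset_set {m \<in> M. 0 < f m}))))"

(* Phi(mu,nu,k) with the choice s = max 0 (-d), s' = max 0 d where
   d = k + l(mu) - l(nu), so that l(nu) + s' - l(mu) - s = k *)
definition Phi :: "nat list \<Rightarrow> nat list \<Rightarrow> int \<Rightarrow> nat list" where
  "Phi mu nu k =
     (let d = k + int (length mu) - int (length nu);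
          s = max 0 (- d); s' = max 0 d
      in maya_partition ((\<lambda>m. 2 * m) ` maya_shift (maya mu) s
                          \<union> (\<lambda>m. 2 * m + 1) ` maya_shift (maya nu) s'))"

definition staircase :: "nat \<Rightarrow> nat list" where
  "staircase k = rev [1..<Suc k]"

definition young :: "nat list \<Rightarrow> (nat \<times> nat) set" where
  "young lam = {(i, j). i < length lam \<and> j < lam ! i}"

definition hook :: "nat list \<Rightarrow> nat \<times> nat \<Rightarrow> nat" where
  "hook lam b = (case b of (i, j) \<Rightarrow>
     (lam ! i - j - 1) + card {i'. i < i' \<and> (i', j) \<in> young lam} + 1)"

definition hook_prod :: "nat list \<Rightarrow> nat" where
  "hook_prod lam = (\<Prod>b\<in>young lam. hook lam b)"

definition hook_prod_odd :: "nat list \<Rightarrow> nat" where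
  "hook_prod_odd lam = (\<Prod>b\<in>{b \<in> young lam. odd (hook lam b)}. hook lam b)"

definition domino_step :: "nat list \<Rightarrow> nat list \<Rightarrow> bool \<Rightarrow> bool" where
  "domino_step lam lam' vert \<longleftrightarrow> is_partition lam' \<and> young lam' \<subseteq> young lam \<and>
     (\<exists>i j. if vert then young lam - young lam' = {(i, j), (i + 1, j)}
                   else young lam - young lam' = {(i, j), (i, j + 1)})"

inductive domino_seq :: "nat list \<Rightarrow> nat list \<Rightarrow> nat \<Rightarrow> bool" where
  refl: "domino_seq lam lam 0"
| step: "domino_step lam lam' vert \<Longrightarrow> domino_seq lam' lam'' v \<Longrightarrow>
         domino_seq lam lam'' (v + (if vert then 1 else 0))"

end

theory Submission
  imports "Jordan_Normal_Form.Determinant" Defs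
begin

text \<open>Split the degrees of \<open>lam\<close> into even and odd ones. The Hermite polynomials of even degrees span a
  space of even polynomials with a basis of orders \<open>0, 2, 4, \<dots>\<close> at the origin, those of odd degrees
  a space of odd polynomials with a basis of orders \<open>1, 3, 5, \<dots>\<close>; these orders are the degrees of
  the core, padded with zero parts. Hence the lowest term of the Wronskian is the product of the two
  base change determinants with the Wronskian of the monomials, and all of these are Vandermonde
  determinants. What is left after cancellation is the quotient, between \<open>lam\<close> and its core, of
  products of odd factors of \<open>n!\<close> over products of odd differences of degrees, which by the
  description of the hooks in a row is the product of the odd hook lengths. The signs come from
  counting inversions between even and odd degrees.\<close>

section \<open>Determinants\<close>

text \<open>Multiplying row \<open>i\<close> of the Wronskian matrix by \<open>x^i\<close> replaces
  the derivatives by the operators \<open>x^i D^i\<close>, which act diagonally on monomials; their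
  eigenvalues are falling factorials, and these have a Vandermonde determinant. The highest term
  follows at once and gives the degree and the leading coefficient of \<open>R\<close>. At the
  origin, several Hermite polynomials of equal parity have equal order, and their lowest terms
  cancel in the determinant; this forces the change of basis. Listing the degrees by parity is
  harmless, since the Wronskian and the Vandermonde product change by the same sign. Padding gives
  the core as many even and as many odd degrees as \<open>lam\<close>, so that the two can be
  compared factor by factor; a padded list is no partition, which is why the lemmas on degrees and
  hooks that serve both assume sortedness only. Domino sequences enter through the parity of
  \<open>v\<close> alone, and the non-vanishing is proved apart from them.\<close>

lemma leibniz_det_eq_det: "leibniz_det n M = det (mat n n (\<lambda>(i, j). M i j))"
  by (auto simp: leibniz_det_def det_def atLeast0LessThan permutes_in_image
      intro!: sum.cong prod.cong arg_cong2[where f = "(*)"])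

lemma leibniz_det_cong:
  assumes "\<And>i j. i < n \<Longrightarrow> j < n \<Longrightarrow> M i j = M' i j"
  shows "leibniz_det n M = leibniz_det n M'"
  unfolding leibniz_det_eq_det using assms
  by (auto intro!: arg_cong[where f = det])

lemma leibniz_det_mult:
  "leibniz_det n (\<lambda>i j. \<Sum>t<n. A i t * B t j) = leibniz_det n A * leibniz_det n B"
proof -
  have "mat n n (\<lambda>(i, j). \<Sum>t<n. A i t * B t j) =
      mat n n (\<lambda>(i, j). A i j) * mat n n (\<lambda>(i, j). B i j)"
    by (rule eq_matI) (auto simp: scalar_prod_def atLeast0LessThan)
  then show ?thesis
    by (simp add: leibniz_det_eq_det det_mult[of _ n])
qed

lemma leibniz_det_transpose: "leibniz_det n (\<lambda>i j. M j i) = leibniz_det n M"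
proof -
  have "mat n n (\<lambda>(i, j). M j i) = transpose_mat (mat n n (\<lambda>(i, j). M i j))"
    by (rule eq_matI) auto
  then show ?thesis
    by (simp add: leibniz_det_eq_det det_transpose[of _ n])
qed

lemma leibniz_det_lower_triangular:
  assumes "\<And>i j. i < j \<Longrightarrow> j < n \<Longrightarrow> M i j = 0"
  shows "leibniz_det n M = (\<Prod>i<n. M i i)"
  unfolding leibniz_det_eq_det
  by (subst det_lower_triangular[of n])
    (use assms in \<open>auto simp: prod_list_diag_prod atLeast0LessThan\<close>)

lemma leibniz_det_upper_triangular:
  assumes "\<And>i j. j < i \<Longrightarrow> i < n \<Longrightarrow> M i j = 0"
  shows "leibniz_det n M = (\<Prod>i<n. M i i)"
  using leibniz_det_lower_triangular[of n "\<lambda>i j. M j i"] assms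
  by (simp add: leibniz_det_transpose[of n M])

text \<open>Each Leibniz term takes one factor from every row and every column. Powers of
  \<open>x\<close> and Hermite weights are extracted this way; where only rows or only columns carry
  a factor, the other one is written as \<open>1\<close> to fit the pattern.\<close>

lemma leibniz_det_scale:
  "leibniz_det n (\<lambda>i j. a i * b j * M i j) =
    (\<Prod>i<n. a i) * (\<Prod>j<n. b j) * leibniz_det n M"
proof -
  have "(\<Prod>i<n. a i * b (p i) * M i (p i)) =
      (\<Prod>i<n. a i) * (\<Prod>j<n. b j) * (\<Prod>i<n. M i (p i))" if "p permutes {..<n}" for p
    using prod.permute[OF that, of b] by (simp add: prod.distrib o_def)
  then show ?thesis
    by (auto simp: leibniz_det_def sum_distrib_left intro!: sum.cong)
qed

lemma leibniz_det_permute_columns: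
  assumes "p permutes {..<n}"
  shows "leibniz_det n (\<lambda>i j. M i (p j)) = of_int (sign p) * leibniz_det n M"
proof -
  have p: "p permutes {0..<n}"
    using assms by (simp add: atLeast0LessThan)
  have "mat n n (\<lambda>(i, j). mat n n (\<lambda>(i, j). M j i) $$ (p i, j)) =
      mat n n (\<lambda>(i, j). M j (p i))"
    using permutes_in_image[OF p] by (intro eq_matI) auto
  with det_permute_rows[OF _ p, of "mat n n (\<lambda>(i, j). M j i)"]
  have "det (mat n n (\<lambda>(i, j). M j (p i))) =
      of_int (sign p) * det (mat n n (\<lambda>(i, j). M j i))"
    by simp
  then show ?thesis
    unfolding leibniz_det_eq_det[symmetric] leibniz_det_transpose[of n M]
      leibniz_det_transpose[of n "\<lambda>i j. M i (p j)"] .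
qed

lemma leibniz_det_block_diagonal:
  fixes A D :: "nat \<Rightarrow> nat \<Rightarrow> 'a::idom"
  shows "leibniz_det (m + n)
      (\<lambda>i j. if i < m \<and> j < m then A i j
        else if m \<le> i \<and> m \<le> j then D (i - m) (j - m) else 0) =
    leibniz_det m A * leibniz_det n D"
proof -
  have "mat (m + n) (m + n)
      (\<lambda>(i, j). if i < m \<and> j < m then A i j
        else if m \<le> i \<and> m \<le> j then D (i - m) (j - m) else 0) =
      four_block_mat (mat m m (\<lambda>(i, j). A i j)) (0\<^sub>m m n) (0\<^sub>m n m)
        (mat n n (\<lambda>(i, j). D i j))"
    by (rule eq_matI) auto
  then show ?thesis
    unfolding leibniz_det_eq_det
    by (simp add: det_four_block_mat_lower_left_zero[of _ m _ n])
qed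

lemma pcompose_leibniz_det:
  "pcompose (leibniz_det n M) q = leibniz_det n (\<lambda>i j. pcompose (M i j) q)"
  by (simp add: leibniz_det_def pcompose_sum pcompose_mult pcompose_prod of_int_poly pcompose_smult)

lemma poly_leibniz_det: "poly (leibniz_det n M) x = leibniz_det n (\<lambda>i j. poly (M i j) x)"
  by (simp add: leibniz_det_def poly_sum poly_prod)

section \<open>Falling factorials, Newton bases and Vandermonde determinants\<close>

definition falling :: "nat \<Rightarrow> nat \<Rightarrow> real" where
  "falling a i = (\<Prod>t<i. real a - real t)"

lemma falling_0 [simp]: "falling a 0 = 1"
  by (simp add: falling_def)

lemma falling_Suc: "falling a (Suc i) = (real a - real i) * falling a i"
  by (simp add: falling_def)

lemma falling_eq_fact: "falling a i = (if i \<le> a then fact a / fact (a - i) else 0)"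
proof (induction i)
  case (Suc i)
  show ?case
  proof (cases "Suc i \<le> a")
    case True
    then have "a - i = Suc (a - Suc i)" by simp
    then have "(fact (a - i) :: real) = (real a - real i) * fact (a - Suc i)"
      using True by (metis Suc_leD fact_Suc of_nat_diff)
    moreover have "real a - real i > 0" using True by simp
    ultimately show ?thesis using Suc True by (simp add: falling_Suc)
  next
    case False
    then show ?thesis using Suc by (auto simp: falling_Suc)
  qed
qed auto

text \<open>The coefficients of \<open>x (x - 1) ... (x - i + 1)\<close> in the Newton basis with
  nodes \<open>a 0, a 1, ...\<close>. The recursion comes from writing the next factor as
  \<open>x - i = (x - a t) + (a t - i)\<close>: the first part raises the basis index by one, the
  second keeps it.\<close>

fun newton_coeff :: "(nat \<Rightarrow> nat) \<Rightarrow> nat \<Rightarrow> nat \<Rightarrow> real" where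
  "newton_coeff a 0 t = (if t = 0 then 1 else 0)"
| "newton_coeff a (Suc i) t =
    (case t of 0 \<Rightarrow> 0 | Suc s \<Rightarrow> newton_coeff a i s) + (real (a t) - real i) * newton_coeff a i t"

lemma newton_coeff_eq_0: "i < t \<Longrightarrow> newton_coeff a i t = 0"
  by (induction i arbitrary: t) (auto split: nat.split)

lemma newton_coeff_diag: "newton_coeff a i i = 1"
  by (induction i) (auto simp: newton_coeff_eq_0)

lemma falling_newton:
  "falling x i = (\<Sum>t\<le>i. newton_coeff a i t * (\<Prod>s<t. real x - real (a s)))"
proof (induction i)
  case (Suc i)
  let ?N = "\<lambda>t. \<Prod>s<t. real x - real (a s)"
  let ?c = "newton_coeff a i"
  have ring: "c * (N * (X - A)) + (A - I) * c * N = (X - I) * (c * N)" for c N X A I :: real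
    by (simp add: algebra_simps)
  have "(\<Sum>t\<le>Suc i. newton_coeff a (Suc i) t * ?N t) =
      (\<Sum>t\<le>Suc i. (case t of 0 \<Rightarrow> 0 | Suc s \<Rightarrow> ?c s) * ?N t) +
      (\<Sum>t\<le>Suc i. (real (a t) - real i) * ?c t * ?N t)"
    by (simp add: distrib_right mult.assoc del: sum.atMost_Suc flip: sum.distrib)
  also have "(\<Sum>t\<le>Suc i. (case t of 0 \<Rightarrow> 0 | Suc s \<Rightarrow> ?c s) * ?N t) =
      (\<Sum>t\<le>i. ?c t * ?N (Suc t))"
    by (simp add: sum.atMost_Suc_shift del: sum.atMost_Suc)
  also have "(\<Sum>t\<le>Suc i. (real (a t) - real i) * ?c t * ?N t) =
      (\<Sum>t\<le>i. (real (a t) - real i) * ?c t * ?N t)"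
    by (simp add: newton_coeff_eq_0)
  also have "(\<Sum>t\<le>i. ?c t * ?N (Suc t)) + \<dots> = (real x - real i) * (\<Sum>t\<le>i. ?c t * ?N t)"
    unfolding sum_distrib_left sum.distrib[symmetric]
    by (rule sum.cong[OF HOL.refl], unfold prod.lessThan_Suc, rule ring)
  also have "\<dots> = falling x (Suc i)"
    by (simp add: falling_Suc Suc)
  finally show ?case ..
qed simp

text \<open>Passing from falling factorials to the Newton basis at the nodes \<open>a 0, a 1, \<dots>\<close> is
  unitriangular, and in the Newton basis the matrix is triangular.\<close>

lemma leibniz_det_falling:
  "leibniz_det n (\<lambda>i j. falling (a j) i) = (\<Prod>j<n. \<Prod>i<j. real (a j) - real (a i))"
proof -
  let ?N = "\<lambda>t j. \<Prod>s<t. real (a j) - real (a s)"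
  have "falling (a j) i = (\<Sum>t<n. newton_coeff a i t * ?N t j)" if "i < n" for i j
    unfolding falling_newton[of "a j" i a]
    by (rule sum.mono_neutral_left) (use that in \<open>auto simp: newton_coeff_eq_0\<close>)
  then have "leibniz_det n (\<lambda>i j. falling (a j) i) =
      leibniz_det n (newton_coeff a) * leibniz_det n ?N"
    unfolding leibniz_det_mult[symmetric] by (intro leibniz_det_cong)
  also have "leibniz_det n (newton_coeff a) = 1"
    by (subst leibniz_det_lower_triangular) (auto simp: newton_coeff_eq_0 newton_coeff_diag)
  also have "leibniz_det n ?N = (\<Prod>j<n. ?N j j)"
    by (rule leibniz_det_upper_triangular) auto
  finally show ?thesis by simp
qed

lemma Vandermonde_Delta_eq_leibniz_det:
  "real_of_int (Vandermonde_Delta xs) = leibniz_det (length xs) (\<lambda>i j. falling (xs ! j) i)"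
  by (simp add: Vandermonde_Delta_def leibniz_det_falling)

lemma Vandermonde_Delta_nonzero: "distinct xs \<Longrightarrow> Vandermonde_Delta xs \<noteq> 0"
  by (auto simp: Vandermonde_Delta_def nth_eq_iff_index_eq)

text \<open>Both sides pick up the sign of the same column permutation, so the quotient of Wronskian
  and Vandermonde product depends only on the set of degrees. Cross-multiplied to avoid dividing by
  the Vandermonde product.\<close>

lemma Wronskian_Vandermonde_permute:
  assumes "mset xs = mset ys"
  shows "smult (real_of_int (Vandermonde_Delta ys)) (Wronskian (map f xs)) =
    smult (real_of_int (Vandermonde_Delta xs)) (Wronskian (map f ys))"
proof -
  obtain p where p: "p permutes {..<length ys}" and xs: "xs = permute_list p ys"
    using mset_eq_permutation[OF assms] by metis
  have len: "length xs = length ys" using xs by simp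
  have nth: "xs ! j = ys ! p j" if "j < length ys" for j
    using xs p that by (simp add: permute_list_nth)
  have W: "Wronskian (map f xs) = of_int (sign p) * Wronskian (map f ys)"
    unfolding Wronskian_def length_map len leibniz_det_permute_columns[OF p, symmetric]
    using permutes_in_image[OF p]
    by (intro leibniz_det_cong) (auto simp: nth len)
  have V: "real_of_int (Vandermonde_Delta xs) =
      of_int (sign p) * real_of_int (Vandermonde_Delta ys)"
    unfolding Vandermonde_Delta_eq_leibniz_det len leibniz_det_permute_columns[OF p, symmetric]
    by (intro leibniz_det_cong) (auto simp: nth)
  show ?thesis
    by (simp add: W V sign_def)
qed

section \<open>Wronskians of Hermite polynomials\<close>

lemma leibniz_det_inverse:
  fixes B :: "nat \<Rightarrow> nat \<Rightarrow> 'a::field"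
  assumes "leibniz_det n B \<noteq> 0"
  shows "\<exists>C. \<forall>i<n. \<forall>j<n. (\<Sum>t<n. B i t * C t j) = (if i = j then 1 else 0) \<and>
    (\<Sum>t<n. C i t * B t j) = (if i = j then 1 else 0)"
proof -
  let ?B = "mat n n (\<lambda>(i, j). B i j)"
  have "det ?B \<noteq> 0" using assms by (simp add: leibniz_det_eq_det)
  from det_non_zero_imp_unit[OF _ this, unfolded Units_def, of n "()"]
  obtain C where C: "C \<in> carrier_mat n n" "C * ?B = 1\<^sub>m n" "?B * C = 1\<^sub>m n"
    by (auto simp: ring_mat_def)
  have "(\<Sum>t<n. B i t * C $$ (t, j)) = (?B * C) $$ (i, j)"
    "(\<Sum>t<n. C $$ (i, t) * B t j) = (C * ?B) $$ (i, j)" if "i < n" "j < n" for i j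
    using C(1) that by (simp_all add: scalar_prod_def atLeast0LessThan)
  then show ?thesis
    unfolding C by (intro exI[of _ "\<lambda>i j. C $$ (i, j)"]) simp
qed

lemma leibniz_det_const_poly: "leibniz_det n (\<lambda>i j. [:M i j:]) = [:leibniz_det n M:]"
proof -
  have sum: "(\<Sum>x\<in>S. [:f x:]) = [:sum f S:]" for f :: "'b \<Rightarrow> 'a" and S
    by (induction S rule: infinite_finite_induct) auto
  have prod: "(\<Prod>x\<in>S. [:f x:]) = [:prod f S:]" for f :: "'b \<Rightarrow> 'a" and S
    by (induction S rule: infinite_finite_induct) (auto simp: one_pCons)
  show ?thesis
    by (simp add: leibniz_det_def sum prod of_int_poly mult.commute)
qed

lemma prod_monom_1: "(\<Prod>x\<in>S. monom 1 (f x)) = monom (1 :: 'a::comm_semiring_1) (sum f S)"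
  by (induction S rule: infinite_finite_induct) (auto simp: mult_monom)

text \<open>Differentiation commutes with constant coefficients, so the Wronskian matrix of
  \<open>fs\<close> is that of \<open>gs\<close> times the constant matrix \<open>B\<close>.\<close>

lemma Wronskian_basis_change:
  assumes "length fs = n" "length gs = n"
    and "\<And>j. j < n \<Longrightarrow> fs ! j = (\<Sum>t<n. smult (B t j) (gs ! t))"
  shows "Wronskian fs = smult (leibniz_det n B) (Wronskian gs)"
proof -
  have "Wronskian fs = leibniz_det n (\<lambda>i j. \<Sum>t<n. (pderiv ^^ i) (gs ! t) * [:B t j:])"
    unfolding Wronskian_def assms(1)
    by (intro leibniz_det_cong) (simp add: assms(3) higher_pderiv_sum higher_pderiv_smult)
  also have "\<dots> = Wronskian gs * [:leibniz_det n B:]"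
    unfolding leibniz_det_mult leibniz_det_const_poly Wronskian_def assms(2) by (rule HOL.refl)
  finally show ?thesis by simp
qed

section \<open>Coefficients of the Hermite polynomials\<close>

lemma coeff_Herm_eq_0: "n < a \<or> odd (n + a) \<Longrightarrow> coeff (Herm n) a = 0"
proof (induction n arbitrary: a rule: Herm.induct)
  case 1
  then have "a \<noteq> 0" by (cases "a = 0") auto
  then show ?case by simp
next
  case 2
  then have "a \<noteq> 1" by auto
  then show ?case by (cases a) (auto simp: coeff_pCons split: nat.split)
next
  case (3 n)
  have "coeff (Herm n) a = 0"
    using 3(3) by (intro 3(2)) (auto simp: less_Suc_eq)
  moreover have "coeff ([:0, 1:] * Herm (Suc n)) a = 0"
  proof (cases a)
    case (Suc a')
    have "coeff (Herm (Suc n)) a' = 0"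
      using 3(3) Suc by (intro 3(1)) auto
    then show ?thesis using Suc by simp
  qed simp
  ultimately show ?case by simp
qed

text \<open>Indexing by the exponent \<open>a\<close> and half the defect \<open>b\<close> avoids
  subtraction; the three-term recurrence then relates \<open>(a, b)\<close> to
  \<open>(a - 1, b)\<close> and \<open>(a, b - 1)\<close>.\<close>

lemma coeff_Herm:
  "coeff (Herm (a + 2 * b)) a = fact (a + 2 * b) / (fact a * fact b) * (- 1 / 2) ^ b"
proof (induction "a + 2 * b" arbitrary: a b rule: Herm.induct)
  case 1
  then show ?case by simp
next
  case 2
  then have "a = 1" "b = 0" by auto
  then show ?case by simp
next
  case (3 n)
  let ?c = "\<lambda>a b :: nat. fact (a + 2 * b) / (fact a * fact b) * (- 1 / 2) ^ b :: real"
  have rec: "coeff (Herm (Suc (Suc n))) a =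
      (case a of 0 \<Rightarrow> 0 | Suc a' \<Rightarrow> coeff (Herm (Suc n)) a') - (real n + 1) * coeff (Herm n) a"
    by (cases a) auto
  show ?case
  proof (cases b)
    case 0
    then obtain a' where a: "a = Suc a'" and n: "Suc n = a'" using 3(3) by (cases a) auto
    have "coeff (Herm (Suc n)) a' = 1"
      using 3(1)[of a' 0] n by simp
    moreover have "coeff (Herm n) a = 0"
      by (rule coeff_Herm_eq_0) (use a n in auto)
    ultimately have "coeff (Herm (Suc (Suc n))) a = 1" unfolding rec using a by simp
    then have "coeff (Herm (a + 2 * b)) a = 1" by (simp only: 3(3))
    then show ?thesis using 0 by simp
  next
    case (Suc b')
    then have n: "n = a + 2 * b'" using 3(3) by simp
    have h: "coeff (Herm n) a = ?c a b'" using 3(2)[OF n] n by simp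
    have e: "(-1/2) ^ b = (-1/2 :: real) * (-1/2) ^ b'" using Suc by simp
    show ?thesis
    proof (cases a)
      case 0
      have f1: "(fact (a + 2 * b) :: real) = (real n + 2) * ((real n + 1) * fact n)"
        unfolding 3(3)[symmetric] by (simp add: algebra_simps)
      have f3: "(fact (a + 2 * b') :: real) = fact n"
        by (simp only: n[symmetric])
      have f4: "(fact a :: real) = 1" using 0 by simp
      have f5: "(fact b :: real) = (real b' + 1) * fact b'"
        by (simp add: Suc algebra_simps)
      have g: "real n + 2 = 2 * (real b' + 1)" using n 0 by simp
      have arith: "- (N * (F / (1 * y) * P)) = 2 * B * (N * F) / (1 * (B * y)) * (- 1 / 2 * P)"
        if "B \<noteq> 0" "y \<noteq> 0" for N F y B P :: real
        using that by (simp add: field_simps)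
      have "coeff (Herm (Suc (Suc n))) a = - ((real n + 1) * ?c a b')"
        unfolding rec h using 0 by simp
      also have "\<dots> = ?c a b"
        unfolding f1 f3 f4 f5 e g by (rule arith) (linarith, simp)
      finally show ?thesis by (simp only: 3(3))
    next
      case (Suc a')
      have n1: "Suc n = a' + 2 * b" using n Suc \<open>b = Suc b'\<close> by simp
      have h1: "coeff (Herm (Suc n)) a' = ?c a' b" using 3(1)[OF n1] n1 by simp
      have f1: "(fact (a + 2 * b) :: real) = (real n + 2) * ((real n + 1) * fact n)"
        unfolding 3(3)[symmetric] by (simp add: algebra_simps)
      have f2: "(fact (a' + 2 * b) :: real) = (real n + 1) * fact n"
        unfolding n1[symmetric] by (simp add: algebra_simps)
      have f3: "(fact (a + 2 * b') :: real) = fact n"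
        by (simp only: n[symmetric])
      have f4: "(fact a :: real) = (real a' + 1) * fact a'"
        by (simp add: Suc algebra_simps)
      have f5: "(fact b :: real) = (real b' + 1) * fact b'"
        by (simp add: \<open>b = Suc b'\<close> algebra_simps)
      \<comment> \<open>This is what closes the recurrence: once the common factors are removed, the
        term \<open>(a - 1, b)\<close> contributes \<open>a\<close> and the term
        \<open>(a, b - 1)\<close> contributes \<open>2 * b\<close>, and
        \<open>a + 2 * b = n + 2\<close> is the factor missing in the factorial.\<close>
      have g: "real n + 2 = (real a' + 1) + 2 * (real b' + 1)"
        using n Suc by simp
      have arith: "N * F / (x * (B * y)) * (- 1 / 2 * P) - N * (F / (A * x * y) * P) =
          (A + 2 * B) * (N * F) / (A * x * (B * y)) * (- 1 / 2 * P)"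
        if "A \<noteq> 0" "B \<noteq> 0" "x \<noteq> 0" "y \<noteq> 0" for N F x y A B P :: real
        using that by (simp add: field_simps)
      have rec': "coeff (Herm (Suc (Suc n))) a =
          coeff (Herm (Suc n)) a' - (real n + 1) * coeff (Herm n) a"
        using rec Suc by simp
      have "coeff (Herm (Suc (Suc n))) a = ?c a' b - (real n + 1) * ?c a b'"
        unfolding rec' h h1 by (rule HOL.refl)
      also have "\<dots> = ?c a b"
        unfolding f1 f2 f3 f4 f5 e g by (rule arith) (linarith, linarith, simp_all)
      finally show ?thesis by (simp only: 3(3))
    qed
  qed
qed

lemma lead_coeff_Herm: "coeff (Herm n) n = 1"
  using coeff_Herm[of n 0] by simp

section \<open>The lowest term of the Wronskian\<close>

lemma coeff_pcompose_square:
  "coeff (pcompose P [:0, 0, 1:]) n = (if even n then coeff P (n div 2) else (0 :: real))"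
proof (induction P arbitrary: n)
  case (pCons c P)
  show ?case
  proof (cases n)
    case (Suc m)
    then show ?thesis
      using pCons by (cases m) (auto simp: pcompose_pCons coeff_pCons)
  qed (auto simp: pcompose_pCons)
qed simp

text \<open>The conjugate \<open>x\<^sup>i D\<^sup>i\<close> of the derivative preserves the space of all \<open>x\<^sup>a G(x\<^sup>2)\<close>.\<close>

lemma monom_higher_pderiv_square:
  fixes G :: "real poly"
  shows "\<exists>g. monom 1 i * (pderiv ^^ i) (monom 1 a * pcompose G [:0, 0, 1:]) =
      monom 1 a * pcompose g [:0, 0, 1:] \<and> poly g 0 = falling a i * poly G 0"
proof (induction i)
  case 0
  show ?case by (intro exI[of _ G]) simp
next
  case (Suc i)
  let ?X = "[:0, 0, 1:] :: real poly"
  define h where "h = (pderiv ^^ i) (monom 1 a * pcompose G ?X)"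
  obtain g where g: "monom 1 i * h = monom 1 a * pcompose g ?X"
    and g0: "poly g 0 = falling a i * poly G 0"
    using Suc unfolding h_def by auto
  have x_pderiv_monom: "[:0, 1:] * pderiv (monom 1 n) = smult (real n) (monom 1 n)" for n
  proof (rule poly_eqI)
    fix k show "coeff ([:0, 1:] * pderiv (monom 1 n)) k = coeff (smult (real n) (monom 1 n)) k"
      by (cases k) (auto simp: coeff_pderiv coeff_monom)
  qed
  have monom_Suc': "monom 1 (Suc i) = [:0, 1:] * (monom 1 i :: real poly)"
    by (simp add: monom_Suc)
  \<comment> \<open>The product rule gives \<open>x^(i+1) h' = x (x^i h)' - i x^i h\<close>. On
    \<open>x^a g(x^2)\<close> this acts as \<open>g \<mapsto> (a - i) g + 2 y g'\<close> with
    \<open>y = x^2\<close>; at \<open>0\<close> only the first summand survives, which is the next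
    factor of the falling factorial.\<close>
  have "monom 1 (Suc i) * pderiv h =
      [:0, 1:] * pderiv (monom 1 i * h) - ([:0, 1:] * pderiv (monom 1 i)) * h"
    unfolding monom_Suc' pderiv_mult by (simp only: algebra_simps)
  also have "\<dots> = [:0, 1:] * pderiv (monom 1 a * pcompose g ?X) -
      smult (real i) (monom 1 a * pcompose g ?X)"
    unfolding x_pderiv_monom by (simp add: g)
  also have "[:0, 1:] * pderiv (monom 1 a * pcompose g ?X) =
      ([:0, 1:] * pderiv (monom 1 a)) * pcompose g ?X +
      monom 1 a * pcompose (pderiv g) ?X * ([:0, 1:] * pderiv ?X)"
    unfolding pderiv_mult pderiv_pcompose by (simp only: algebra_simps)
  also have "[:0, 1:] * pderiv ?X = smult 2 (pcompose [:0, 1:] ?X)"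
    by (simp add: pderiv_pCons pcompose_pCons)
  also have "[:0, 1:] * pderiv (monom 1 a) * pcompose g ?X +
      monom 1 a * pcompose (pderiv g) ?X * smult 2 (pcompose [:0, 1:] ?X) -
      smult (real i) (monom 1 a * pcompose g ?X) =
    monom 1 a * pcompose (smult (real a - real i) g + smult 2 ([:0, 1:] * pderiv g)) ?X"
    unfolding x_pderiv_monom
    by (simp add: pcompose_add pcompose_diff pcompose_smult pcompose_mult smult_diff_left algebra_simps
        del: mult_pCons_left mult_pCons_right)
  finally have "monom 1 (Suc i) * (pderiv ^^ Suc i) (monom 1 a * pcompose G ?X) =
      monom 1 a * pcompose (smult (real a - real i) g + smult 2 ([:0, 1:] * pderiv g)) ?X"
    unfolding h_def by simp
  moreover have "poly (smult (real a - real i) g + smult 2 ([:0, 1:] * pderiv g)) 0 =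
      falling a (Suc i) * poly G 0"
    by (simp add: g0 falling_Suc)
  ultimately show ?case by blast
qed

text \<open>After row \<open>i\<close> is multiplied by \<open>x^i\<close>, all entries of column
  \<open>j\<close> are \<open>x^(as ! j)\<close> times a polynomial in \<open>x^2\<close>. Pulling
  these powers out leaves a determinant in \<open>x^2\<close> whose value at \<open>0\<close> is
  built from falling factorials of the orders. The power of \<open>x\<close> stays on the left so
  that nothing has to be divided.\<close>

lemma Wronskian_lowest_term:
  assumes "\<And>j. j < length fs \<Longrightarrow> fs ! j = monom 1 (as ! j) * pcompose (G j) [:0, 0, 1:]"
    and "\<And>j. j < length fs \<Longrightarrow> poly (G j) 0 = 1"
    and "length as = length fs"
  shows "\<exists>Q. monom 1 (\<Sum>i<length fs. i) * Wronskian fs =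
      monom 1 (sum_list as) * pcompose Q [:0, 0, 1:] \<and>
      poly Q 0 = real_of_int (Vandermonde_Delta as)"
proof -
  let ?n = "length fs" and ?X = "[:0, 0, 1:] :: real poly"
  have "\<forall>i j. \<exists>g. monom 1 i * (pderiv ^^ i) (monom 1 (as ! j) * pcompose (G j) ?X) =
      monom 1 (as ! j) * pcompose g ?X \<and> poly g 0 = falling (as ! j) i * poly (G j) 0"
    using monom_higher_pderiv_square by blast
  then obtain g where g:
    "\<And>i j. monom 1 i * (pderiv ^^ i) (monom 1 (as ! j) * pcompose (G j) ?X) =
      monom 1 (as ! j) * pcompose (g i j) ?X"
    "\<And>i j. poly (g i j) 0 = falling (as ! j) i * poly (G j) 0"
    by metis
  have "monom 1 (\<Sum>i<?n. i) * Wronskian fs =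
      leibniz_det ?n (\<lambda>i j. monom 1 i * 1 * (pderiv ^^ i) (fs ! j))"
    unfolding leibniz_det_scale by (simp add: prod_monom_1 Wronskian_def)
  also have "\<dots> = leibniz_det ?n (\<lambda>i j. 1 * monom 1 (as ! j) * pcompose (g i j) ?X)"
    by (intro leibniz_det_cong) (simp add: assms(1) g)
  also have "\<dots> = monom 1 (sum_list as) * pcompose (leibniz_det ?n g) ?X"
    unfolding leibniz_det_scale
    by (simp add: prod_monom_1 pcompose_leibniz_det sum_list_sum_nth assms(3) atLeast0LessThan)
  finally have "monom 1 (\<Sum>i<?n. i) * Wronskian fs =
      monom 1 (sum_list as) * pcompose (leibniz_det ?n g) ?X" .
  moreover have "poly (leibniz_det ?n g) 0 = real_of_int (Vandermonde_Delta as)"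
    unfolding poly_leibniz_det Vandermonde_Delta_eq_leibniz_det assms(3)
    by (intro leibniz_det_cong) (simp add: g assms(2))
  ultimately show ?thesis by blast
qed

text \<open>Inverting the matrix of the first \<open>n\<close> coefficients yields combinations
  \<open>Q i\<close> whose first \<open>n\<close> coefficients are those of \<open>x^i\<close>, so
  \<open>Q i = x^i G i\<close> with \<open>G i\<close> equal to \<open>1\<close> at
  \<open>0\<close>. The base change back is the coefficient matrix itself, so its determinant is
  explicit even though the \<open>G i\<close> are not.\<close>

lemma echelon_basis:
  fixes P :: "nat \<Rightarrow> 'a::field poly"
  assumes "leibniz_det n (\<lambda>i j. coeff (P j) i) \<noteq> 0"
  obtains G where "\<And>i. i < n \<Longrightarrow> poly (G i) 0 = 1"
    and "\<And>j. j < n \<Longrightarrow> P j = (\<Sum>i<n. smult (coeff (P j) i) (monom 1 i * G i))"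
proof -
  obtain C where
    BC: "\<And>i j. i < n \<Longrightarrow> j < n \<Longrightarrow> (\<Sum>t<n. coeff (P t) i * C t j) = (if i = j then 1 else 0)"
    and CB: "\<And>i j. i < n \<Longrightarrow> j < n \<Longrightarrow> (\<Sum>t<n. C i t * coeff (P j) t) = (if i = j then 1 else 0)"
    using leibniz_det_inverse[OF assms] by blast
  define Q where "Q i = (\<Sum>t<n. smult (C t i) (P t))" for i
  have coeff_Q: "coeff (Q i) s = (if s = i then 1 else 0)" if "i < n" "s < n" for i s
    using BC[OF that(2) that(1)] by (simp add: Q_def coeff_sum mult.commute)
  have "\<exists>G. Q i = monom 1 i * G" if "i < n" for i
  proof -
    have "monom 1 i dvd Q i"
      unfolding monom_1_dvd_iff' using coeff_Q that by auto
    then show ?thesis by (auto elim: dvdE)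
  qed
  then obtain G where G: "\<And>i. i < n \<Longrightarrow> Q i = monom 1 i * G i" by metis
  show thesis
  proof (rule that[of G])
    fix i assume i: "i < n"
    have "coeff (Q i) i = poly (G i) 0"
      by (simp add: G i Polynomial.coeff_monom_mult poly_0_coeff_0)
    then show "poly (G i) 0 = 1" using coeff_Q[OF i i] by simp
  next
    fix j assume j: "j < n"
    have smult_sum_right: "smult c (\<Sum>i<n. f i) = (\<Sum>i<n. smult c (f i))"
      for c and f :: "nat \<Rightarrow> 'a poly"
      by (simp add: poly_eq_iff coeff_sum sum_distrib_left)
    have "(\<Sum>i<n. smult (coeff (P j) i) (monom 1 i * G i)) =
        (\<Sum>i<n. smult (coeff (P j) i) (Q i))"
      by (simp add: G)
    also have "\<dots> = (\<Sum>i<n. \<Sum>t<n. smult (C t i * coeff (P j) i) (P t))"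
      by (simp add: Q_def smult_sum_right mult.commute)
    also have "\<dots> = (\<Sum>t<n. smult (\<Sum>i<n. C t i * coeff (P j) i) (P t))"
      by (subst sum.swap) (simp add: smult_sum)
    also have "\<dots> = (\<Sum>t<n. if t = j then P t else 0)"
      using CB j by (intro sum.cong) auto
    also have "\<dots> = P j" using j by simp
    finally show "P j = (\<Sum>i<n. smult (coeff (P j) i) (monom 1 i * G i))" ..
  qed
qed

text \<open>The lowest non-zero coefficient of \<open>Herm n\<close>: the constant one for even
  \<open>n\<close>, the linear one for odd \<open>n\<close>.\<close>

definition herm_weight :: "nat \<Rightarrow> real" where
  "herm_weight n = fact n / fact (n div 2) * (- 1 / 2) ^ (n div 2)"

lemma herm_weight_nonzero: "herm_weight n \<noteq> 0"
  by (simp add: herm_weight_def)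

text \<open>In a fixed parity \<open>p\<close> the coefficient splits into a factor of the row
  \<open>i\<close>, a factor of the column \<open>m\<close> and a falling factorial, so the
  determinant of these coefficients is a scaled Vandermonde determinant in the halves
  \<open>m\<close>.\<close>

lemma coeff_Herm_parity:
  assumes "p \<le> 1"
  shows "coeff (Herm (2 * m + p)) (2 * i + p) =
    inverse (herm_weight (2 * i + p) * fact i) * herm_weight (2 * m + p) * falling m i"
proof (cases "i \<le> m")
  case True
  then obtain b where m: "m = i + b" using le_Suc_ex by blast
  have half: "(2 * k + p) div 2 = k" for k using assms by auto
  have weight: "herm_weight (2 * k + p) = fact (2 * k + p) / fact k * (- 1 / 2) ^ k" for k
    unfolding herm_weight_def half by (rule HOL.refl)
  have n: "2 * m + p = (2 * i + p) + 2 * b" using m by simp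
  have coeff: "coeff (Herm (2 * m + p)) (2 * i + p) =
      fact (2 * m + p) / (fact (2 * i + p) * fact b) * (- 1 / 2) ^ b"
    unfolding n by (rule coeff_Herm)
  have falling: "falling m i = fact m / fact b" using m by (simp add: falling_eq_fact)
  show ?thesis
    unfolding coeff falling weight by (simp add: m power_add field_simps)
next
  case False
  then show ?thesis by (simp add: coeff_Herm_eq_0 falling_eq_fact)
qed

lemma Herm_parity:
  assumes "p \<le> 1"
  obtains P where "Herm (2 * m + p) = monom 1 p * pcompose P [:0, 0, 1:]"
    and "\<And>i. coeff P i = coeff (Herm (2 * m + p)) (2 * i + p)"
proof -
  define P where "P = (\<Sum>i\<le>m. monom (coeff (Herm (2 * m + p)) (2 * i + p)) i)"
  have P: "coeff P i = coeff (Herm (2 * m + p)) (2 * i + p)" for i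
    by (auto simp: P_def coeff_sum if_distrib sum.delta' coeff_Herm_eq_0 cong: if_cong)
  have "Herm (2 * m + p) = monom 1 p * pcompose P [:0, 0, 1:]"
  proof (rule poly_eqI)
    fix n
    show "coeff (Herm (2 * m + p)) n = coeff (monom 1 p * pcompose P [:0, 0, 1:]) n"
    proof (cases "n < p \<or> odd (n - p)")
      case True
      then have "odd (2 * m + p + n)" using assms by (auto simp: le_Suc_eq)
      then show ?thesis
        using True by (auto simp: coeff_Herm_eq_0 Polynomial.coeff_monom_mult coeff_pcompose_square)
    next
      case False
      then have "even (n - p)" by blast
      then have "2 * ((n - p) div 2) = n - p" by (rule dvd_mult_div_cancel)
      then have "n = 2 * ((n - p) div 2) + p" using False by linarith
      then show ?thesis
        using False by (auto simp: Polynomial.coeff_monom_mult coeff_pcompose_square P)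
    qed
  qed
  with P that show thesis by blast
qed

text \<open>The echelon basis is taken in the variable \<open>x^2\<close>, after division by
  \<open>x^p\<close>. Distinctness makes the Vandermonde factor, and with it the base change
  determinant, non-zero.\<close>

lemma Herm_parity_basis:
  assumes "p \<le> 1" "distinct ms"
  shows "\<exists>B G. (\<forall>j<length ms. Herm (2 * ms ! j + p) =
      (\<Sum>i<length ms. smult (B i j) (monom 1 (2 * i + p) * pcompose (G i) [:0, 0, 1:]))) \<and>
    (\<forall>i<length ms. poly (G i) 0 = 1) \<and>
    leibniz_det (length ms) B =
      (\<Prod>j<length ms. herm_weight (2 * ms ! j + p) / (herm_weight (2 * j + p) * fact j)) *
      real_of_int (Vandermonde_Delta ms)"
proof -
  let ?n = "length ms" and ?X = "[:0, 0, 1:] :: real poly"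
  have "\<forall>m. \<exists>P. Herm (2 * m + p) = monom 1 p * pcompose P ?X \<and>
      (\<forall>i. coeff P i = coeff (Herm (2 * m + p)) (2 * i + p))"
    using Herm_parity[OF assms(1)] by metis
  then obtain P where P: "\<And>m. Herm (2 * m + p) = monom 1 p * pcompose (P m) ?X"
    "\<And>m i. coeff (P m) i = coeff (Herm (2 * m + p)) (2 * i + p)"
    by metis
  define B where "B i j = coeff (P (ms ! j)) i" for i j
  have det: "leibniz_det ?n B =
      (\<Prod>j<?n. herm_weight (2 * ms ! j + p) / (herm_weight (2 * j + p) * fact j)) *
      real_of_int (Vandermonde_Delta ms)"
    unfolding B_def P(2) coeff_Herm_parity[OF assms(1)] leibniz_det_scale
      Vandermonde_Delta_eq_leibniz_det prod.distrib[symmetric]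
    by (intro arg_cong2[where f = "(*)"] prod.cong) (auto simp: field_simps)
  moreover have "leibniz_det ?n B \<noteq> 0"
    unfolding det using Vandermonde_Delta_nonzero[OF assms(2)]
    by (auto simp: herm_weight_nonzero)
  then obtain G where G: "\<And>i. i < ?n \<Longrightarrow> poly (G i) 0 = 1"
    "\<And>j. j < ?n \<Longrightarrow> P (ms ! j) = (\<Sum>i<?n. smult (B i j) (monom 1 i * G i))"
    using echelon_basis[of ?n "\<lambda>j. P (ms ! j)"] unfolding B_def by metis
  have "pcompose (monom 1 i) ?X = monom 1 (2 * i)" for i
  proof (rule poly_eqI)
    fix n
    show "coeff (pcompose (monom 1 i) ?X) n = coeff (monom 1 (2 * i)) n"
      unfolding coeff_pcompose_square coeff_monom by (cases "2 * i = n") auto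
  qed
  then have "Herm (2 * ms ! j + p) =
      (\<Sum>i<?n. smult (B i j) (monom 1 (2 * i + p) * pcompose (G i) ?X))" if "j < ?n" for j
    unfolding P(1)
    unfolding sum_distrib_left G(2)[OF that] pcompose_sum
    by (intro sum.cong)
      (simp_all add: pcompose_smult pcompose_mult mult_monom add.commute flip: mult.assoc)
  ultimately show ?thesis using G(1) by blast
qed

lemma Wronskian_Herm_lowest_term:
  fixes ms ms' :: "nat list"
  defines "as \<equiv> map (\<lambda>i. 2 * i) [0..<length ms] @ map (\<lambda>i. 2 * i + 1) [0..<length ms']"
  assumes "distinct ms" "distinct ms'"
  shows "\<exists>Q. monom 1 (\<Sum>i<length ms + length ms'. i) *
        Wronskian (map Herm (map (\<lambda>m. 2 * m) ms @ map (\<lambda>m. 2 * m + 1) ms')) =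
      monom 1 (sum_list as) * pcompose Q [:0, 0, 1:] \<and>
      poly Q 0 = real_of_int (Vandermonde_Delta as) *
        ((\<Prod>j<length ms. herm_weight (2 * ms ! j) / (herm_weight (2 * j) * fact j)) *
          real_of_int (Vandermonde_Delta ms)) *
        ((\<Prod>j<length ms'. herm_weight (2 * ms' ! j + 1) / (herm_weight (2 * j + 1) * fact j)) *
          real_of_int (Vandermonde_Delta ms'))"
proof -
  let ?e = "length ms" and ?o = "length ms'" and ?X = "[:0, 0, 1:] :: real poly"
  let ?F = "\<lambda>i G. monom 1 i * pcompose G ?X :: real poly"
  obtain B G where B:
    "\<And>j. j < ?e \<Longrightarrow> Herm (2 * ms ! j) = (\<Sum>i<?e. smult (B i j) (?F (2 * i) (G i)))"
    "\<And>i. i < ?e \<Longrightarrow> poly (G i) 0 = 1"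
    "leibniz_det ?e B =
      (\<Prod>j<?e. herm_weight (2 * ms ! j) / (herm_weight (2 * j) * fact j)) *
      real_of_int (Vandermonde_Delta ms)"
    using Herm_parity_basis[OF zero_le_one assms(2)] unfolding add_0_right by blast
  obtain B' G' where B':
    "\<And>j. j < ?o \<Longrightarrow> Herm (2 * ms' ! j + 1) =
      (\<Sum>i<?o. smult (B' i j) (?F (2 * i + 1) (G' i)))"
    "\<And>i. i < ?o \<Longrightarrow> poly (G' i) 0 = 1"
    "leibniz_det ?o B' =
      (\<Prod>j<?o. herm_weight (2 * ms' ! j + 1) / (herm_weight (2 * j + 1) * fact j)) *
      real_of_int (Vandermonde_Delta ms')"
    using Herm_parity_basis[OF order_refl assms(3)] by blast
  define gs where "gs = map (\<lambda>i. ?F (2 * i) (G i)) [0..<?e] @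
    map (\<lambda>i. ?F (2 * i + 1) (G' i)) [0..<?o]"
  \<comment> \<open>Block diagonal, because even Hermite polynomials involve only the even basis
    elements and odd ones only the odd.\<close>
  define C where "C i j = (if i < ?e \<and> j < ?e then B i j
    else if ?e \<le> i \<and> ?e \<le> j then B' (i - ?e) (j - ?e) else 0)" for i j
  have len: "length gs = ?e + ?o" by (simp add: gs_def)
  have split: "(\<Sum>t<?e + ?o. f t) = (\<Sum>t<?e. f t) + (\<Sum>t<?o. f (?e + t))"
    for f :: "nat \<Rightarrow> real poly"
    using sum.atLeastLessThan_concat[of 0 ?e "?e + ?o" f] sum.shift_bounds_nat_ivl[of f 0 ?e ?o]
    by (simp add: atLeast0LessThan add.commute)
  have "Wronskian (map Herm (map (\<lambda>m. 2 * m) ms @ map (\<lambda>m. 2 * m + 1) ms')) =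
      smult (leibniz_det (?e + ?o) C) (Wronskian gs)"
  proof (rule Wronskian_basis_change)
    fix j assume j: "j < ?e + ?o"
    show "map Herm (map (\<lambda>m. 2 * m) ms @ map (\<lambda>m. 2 * m + 1) ms') ! j =
        (\<Sum>t<?e + ?o. smult (C t j) (gs ! t))"
    proof (cases "j < ?e")
      case True
      then show ?thesis
        by (simp add: split gs_def C_def nth_append B(1))
    next
      case False
      then have "j - ?e < ?o" using j by simp
      then show ?thesis using False
        by (simp add: split gs_def C_def nth_append B'(1)[simplified])
    qed
  qed (simp_all add: len)
  also have "leibniz_det (?e + ?o) C = leibniz_det ?e B * leibniz_det ?o B'"
    unfolding C_def by (rule leibniz_det_block_diagonal)
  finally have W: "Wronskian (map Herm (map (\<lambda>m. 2 * m) ms @ map (\<lambda>m. 2 * m + 1) ms')) =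
      smult (leibniz_det ?e B * leibniz_det ?o B') (Wronskian gs)" .
  let ?G = "\<lambda>j. if j < ?e then G j else G' (j - ?e)"
  have gs: "gs ! j = ?F (as ! j) (?G j)" if "j < ?e + ?o" for j
  proof (cases "j < ?e")
    case False
    then have "j - ?e < ?o" using that by simp
    then show ?thesis using False by (simp add: gs_def as_def nth_append)
  qed (simp add: gs_def as_def nth_append)
  have G: "poly (?G j) 0 = 1" if "j < ?e + ?o" for j
    using that B(2) B'(2) by simp
  have "length as = ?e + ?o" by (simp add: as_def)
  then obtain Q where Q: "monom 1 (\<Sum>i<?e + ?o. i) * Wronskian gs =
      monom 1 (sum_list as) * pcompose Q ?X"
    "poly Q 0 = real_of_int (Vandermonde_Delta as)"
    using Wronskian_lowest_term[of gs as ?G, unfolded len, OF gs G] by blast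
  show ?thesis
    unfolding W B(3)[symmetric] B'(3)[symmetric]
    by (intro exI[of _ "smult (leibniz_det ?e B * leibniz_det ?o B') Q"])
      (simp add: Q pcompose_smult)
qed

section \<open>The highest term of the Wronskian\<close>

lemma coeff_monom_higher_pderiv:
  "coeff (monom 1 i * (pderiv ^^ i) f) n = falling n i * coeff (f :: real poly) n"
proof (induction i)
  case (Suc i)
  show ?case
  proof (cases "Suc i \<le> n")
    case True
    then have "coeff (monom 1 (Suc i) * (pderiv ^^ Suc i) f) n =
        (real n - real i) * coeff (monom 1 i * (pderiv ^^ i) f) n"
      by (simp add: Polynomial.coeff_monom_mult coeff_pderiv Suc_diff_Suc of_nat_diff)
    then show ?thesis unfolding Suc by (simp add: falling_Suc)
  next
    case False
    then show ?thesis by (simp add: Polynomial.coeff_monom_mult falling_eq_fact)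
  qed
qed simp

text \<open>Coefficients are read at bounds for the degrees, since an entry of the Wronskian matrix
  may fall below the bound of its column: it vanishes when the order of derivation exceeds the
  degree.\<close>

lemma coeff_mult_degree_bounds:
  assumes "degree p \<le> a" "degree q \<le> b"
  shows "coeff (p * q) (a + b) = coeff p a * (coeff q b :: 'a::comm_semiring_0)"
proof (cases "degree p = a \<and> degree q = b")
  case True
  then show ?thesis using coeff_mult_degree_sum[of p q] by auto
next
  case False
  then have "degree p < a \<or> degree q < b" using assms by auto
  moreover from this have "degree (p * q) < a + b"
    using degree_mult_le[of p q] assms by linarith
  ultimately show ?thesis by (auto simp: coeff_eq_0)
qed

lemma coeff_prod_degree_bounds:
  fixes p :: "'b \<Rightarrow> 'a::comm_semiring_1 poly"
  assumes "finite S" "\<And>x. x \<in> S \<Longrightarrow> degree (p x) \<le> d x"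
  shows "degree (prod p S) \<le> sum d S \<and> coeff (prod p S) (sum d S) = (\<Prod>x\<in>S. coeff (p x) (d x))"
  using assms
proof (induction S rule: finite_induct)
  case (insert x S)
  then have x: "degree (p x) \<le> d x" and S: "degree (prod p S) \<le> sum d S"
    and c: "coeff (prod p S) (sum d S) = (\<Prod>x\<in>S. coeff (p x) (d x))" by auto
  have "degree (p x * prod p S) \<le> d x + sum d S"
    using degree_mult_le[of "p x" "prod p S"] x S by linarith
  then show ?case
    using insert.hyps coeff_mult_degree_bounds[OF x S] c by simp
qed simp

text \<open>The operators \<open>x^i D^i\<close> do not raise degrees, and \<open>Herm\<close> is
  monic, so every Leibniz term is bounded by the sum of the degrees and has a product of falling
  factorials as coefficient there. The determinant of these is the Vandermonde product.\<close>

lemma Wronskian_Herm_top_term: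
  defines "W \<equiv> \<lambda>ns. monom 1 (\<Sum>i<length ns. i) * Wronskian (map Herm ns)"
  shows "coeff (W ns) (sum_list ns) = real_of_int (Vandermonde_Delta ns)"
    and "degree (W ns) \<le> sum_list ns"
proof -
  let ?n = "length ns"
  define E where "E i j = monom 1 i * (pderiv ^^ i) (Herm (ns ! j))" for i j
  have "W ns = leibniz_det ?n (\<lambda>i j. monom 1 i * 1 * (pderiv ^^ i) (Herm (ns ! j)))"
    unfolding leibniz_det_scale W_def Wronskian_def length_map
    by (simp add: prod_monom_1 cong: leibniz_det_cong)
  moreover have "E = (\<lambda>i j. monom 1 i * (pderiv ^^ i) (Herm (ns ! j)))"
    by (simp add: E_def fun_eq_iff)
  ultimately have W: "W ns = leibniz_det ?n E" by simp
  have coeff_E: "coeff (E i j) n = falling n i * coeff (Herm (ns ! j)) n" for i j n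
    unfolding E_def by (rule coeff_monom_higher_pderiv)
  have deg_E: "degree (E i j) \<le> ns ! j" for i j
    by (rule degree_le) (simp add: coeff_E coeff_Herm_eq_0)
  have prod: "degree (\<Prod>i<?n. E i (p i)) \<le> sum_list ns \<and>
      coeff (\<Prod>i<?n. E i (p i)) (sum_list ns) = (\<Prod>i<?n. falling (ns ! p i) i)"
    if "p permutes {..<?n}" for p
  proof -
    have "(\<Sum>i<?n. ns ! p i) = sum_list ns"
      using sum.permute[OF that, of "\<lambda>i. ns ! i"]
      by (simp add: sum_list_sum_nth atLeast0LessThan o_def)
    then show ?thesis
      using coeff_prod_degree_bounds[of "{..<?n}" "\<lambda>i. E i (p i)" "\<lambda>i. ns ! p i"]
      by (simp add: deg_E coeff_E lead_coeff_Herm)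
  qed
  have "of_int (sign p) * q = smult (of_int (sign p)) q" for p :: "nat \<Rightarrow> nat" and q :: "real poly"
    by (simp add: of_int_poly)
  then have W': "W ns = (\<Sum>p | p permutes {..<?n}. smult (of_int (sign p)) (\<Prod>i<?n. E i (p i)))"
    unfolding W leibniz_det_def by simp
  show "coeff (W ns) (sum_list ns) = real_of_int (Vandermonde_Delta ns)"
    unfolding W' Vandermonde_Delta_eq_leibniz_det leibniz_det_def coeff_sum
    by (intro sum.cong) (auto simp: prod)
  show "degree (W ns) \<le> sum_list ns"
    unfolding W' using prod
    by (intro degree_sum_le) (auto intro: order_trans[OF degree_smult_le] simp: finite_permutations)
qed

section \<open>Dominoes and hooks\<close>

lemma young_eq_Sigma: "young lam = (SIGMA i:{..<length lam}. {..<lam ! i})"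
  by (auto simp: young_def)

lemma finite_young: "finite (young lam)"
  by (simp add: young_eq_Sigma)

lemma sum_row_young: "(\<Sum>(i, j)\<in>young lam. f i) = (\<Sum>i<length lam. f i * lam ! i :: nat)"
  by (simp add: young_eq_Sigma sum.Sigma[symmetric] mult.commute)

text \<open>A horizontal domino contributes an even number to the sum of the row indices of all boxes, a
  vertical one an odd number; hence the parity of the number of vertical dominoes.\<close>

lemma domino_seq_parity:
  "domino_seq lam lam' v \<Longrightarrow>
    even (v + (\<Sum>i<length lam. i * lam ! i) + (\<Sum>i<length lam'. i * lam' ! i))"
proof (induction rule: domino_seq.induct)
  case (refl lam)
  then show ?case by simp
next
  case (step lam lam' vert lam'' v)
  let ?s = "\<lambda>lam :: nat list. \<Sum>i<length lam. i * lam ! i"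
  from step(1) have sub: "young lam' \<subseteq> young lam" by (simp add: domino_step_def)
  have "?s lam = (\<Sum>(i, j)\<in>young lam - young lam'. i) + ?s lam'"
    unfolding sum_row_young[symmetric] by (rule sum.subset_diff[OF sub finite_young])
  moreover have "even ((\<Sum>(i, j)\<in>young lam - young lam'. i) + (if vert then 1 else 0))"
    using step(1) by (auto simp: domino_step_def split: if_splits)
  ultimately show ?case using step(3) by auto
qed

lemma length_degvec [simp]: "length (degvec lam) = length lam"
  by (simp add: degvec_def)

lemma nth_degvec: "i < length lam \<Longrightarrow> degvec lam ! i = lam ! i + (length lam - 1 - i)"
  by (simp add: degvec_def)

lemma sorted_ge_nth:
  "sorted_wrt (\<ge>) lam \<Longrightarrow> i \<le> j \<Longrightarrow> j < length lam \<Longrightarrow> lam ! j \<le> (lam ! i :: nat)"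
  by (cases "i = j") (auto simp: sorted_wrt_iff_nth_less)

lemma degvec_strict_antimono:
  assumes "sorted_wrt (\<ge>) lam" "i < j" "j < length lam"
  shows "degvec lam ! j < degvec lam ! i"
  using sorted_ge_nth[of lam i j] assms by (simp add: nth_degvec)

lemma distinct_degvec: "sorted_wrt (\<ge>) lam \<Longrightarrow> distinct (degvec lam)"
  using degvec_strict_antimono[of lam]
  by (auto simp: distinct_conv_nth neq_iff)

lemma sum_degvec: "sum_list (degvec lam) = sum_list lam + (\<Sum>i<length lam. i)"
proof -
  have "sum_list (degvec lam) = (\<Sum>i<length lam. lam ! i + (length lam - 1 - i))"
    by (simp add: sum_list_sum_nth nth_degvec atLeast0LessThan)
  also have "\<dots> = (\<Sum>i<length lam. lam ! i) + (\<Sum>i<length lam. length lam - 1 - i)"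
    by (rule sum.distrib)
  also have "(\<Sum>i<length lam. length lam - 1 - i) = (\<Sum>i<length lam. i)"
    using sum.nat_diff_reindex[of "\<lambda>i. i" "length lam"] by simp
  finally show ?thesis by (simp add: sum_list_sum_nth atLeast0LessThan)
qed

lemma hook_eq:
  assumes "(i, j) \<in> young lam"
  shows "hook lam (i, j) =
    lam ! i - j + card {i' \<in> {i<..<length lam}. j < lam ! i'}"
proof -
  have "{i'. i < i' \<and> (i', j) \<in> young lam} = {i' \<in> {i<..<length lam}. j < lam ! i'}"
    by (auto simp: young_def)
  then have "hook lam (i, j) =
      (lam ! i - j - 1) + card {i' \<in> {i<..<length lam}. j < lam ! i'} + 1"
    by (simp add: hook_def)
  moreover have "j < lam ! i" using assms by (simp add: young_def)
  ultimately show ?thesis by linarith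
qed

definition odd_fact :: "nat \<Rightarrow> nat" where
  "odd_fact n = \<Prod>{d \<in> {1..n}. odd d}"

text \<open>The hook lengths in row \<open>i\<close> are exactly the numbers in \<open>{1..n\<^sub>i}\<close> that are not of the form
  \<open>n\<^sub>i - n\<^sub>j\<close> with \<open>i < j\<close>.\<close>

lemma hooks_in_row:
  assumes "sorted_wrt (\<ge>) lam" "i < length lam"
  defines "H \<equiv> (\<lambda>j. hook lam (i, j)) ` {..<lam ! i}"
    and "D \<equiv> (\<lambda>i'. degvec lam ! i - degvec lam ! i') ` {i<..<length lam}"
  shows "inj_on (\<lambda>j. hook lam (i, j)) {..<lam ! i}"
    and "inj_on (\<lambda>i'. degvec lam ! i - degvec lam ! i') {i<..<length lam}"
    and "H \<inter> D = {}" and "H \<union> D = {1..degvec lam ! i}"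
proof -
  let ?n = "\<lambda>i. degvec lam ! i" and ?l = "length lam"
  let ?c = "\<lambda>j. card {i' \<in> {i<..<?l}. j < lam ! i'}"
  have hook: "hook lam (i, j) = lam ! i - j + ?c j" if "j < lam ! i" for j
    using that assms by (intro hook_eq) (simp add: young_def)
  have c_mono: "?c j' \<le> ?c j" if "j \<le> j'" for j j'
    using that by (intro card_mono) auto
  have c_le: "?c j \<le> ?l - 1 - i" for j
  proof -
    have "?c j \<le> card {i<..<?l}" by (intro card_mono) auto
    then show ?thesis by simp
  qed
  have dec: "hook lam (i, j') < hook lam (i, j)" if "j < j'" "j' < lam ! i" for j j'
    using c_mono[of j j'] that by (simp add: hook)
  show inj: "inj_on (\<lambda>j. hook lam (i, j)) {..<lam ! i}"
  proof (rule inj_onI)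
    fix a b assume "a \<in> {..<lam ! i}" "b \<in> {..<lam ! i}" "hook lam (i, a) = hook lam (i, b)"
    then show "a = b" using dec[of a b] dec[of b a] by (cases a b rule: linorder_cases) auto
  qed
  have lt: "?n i'' < ?n i'" if "i' < i''" "i'' < ?l" for i' i''
    using degvec_strict_antimono[OF assms(1) that] .
  show inj': "inj_on (\<lambda>i'. ?n i - ?n i') {i<..<?l}"
  proof (rule inj_onI)
    fix a b assume ab: "a \<in> {i<..<?l}" "b \<in> {i<..<?l}" "?n i - ?n a = ?n i - ?n b"
    then have "?n a = ?n b" using lt[of i a] lt[of i b] by auto
    then show "a = b" using ab lt[of a b] lt[of b a] by (cases a b rule: linorder_cases) auto
  qed
  \<comment> \<open>If row \<open>i'\<close> reaches column \<open>j\<close>, then so do all rows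
    between, the leg is at least \<open>i' - i\<close>, and the hook length exceeds the difference.
    Otherwise the leg is less than \<open>i' - i\<close>, and the hook length is smaller than the
    difference.\<close>
  show disj: "H \<inter> D = {}"
  proof -
    have False if j: "j < lam ! i" and i': "i < i'" "i' < ?l"
      and eq: "hook lam (i, j) = ?n i - ?n i'" for j i'
    proof (cases "j < lam ! i'")
      case True
      have "{i<..i'} \<subseteq> {i'' \<in> {i<..<?l}. j < lam ! i''}"
        using True i' sorted_ge_nth[OF assms(1)] by (auto intro: less_le_trans)
      then have "card {i<..i'} \<le> ?c j" by (intro card_mono) auto
      then show False
        using eq i' True j assms(2) by (simp add: hook nth_degvec)
    next
      case False
      have "{i'' \<in> {i<..<?l}. j < lam ! i''} \<subseteq> {i<..<i'}"
      proof
        fix x assume x: "x \<in> {i'' \<in> {i<..<?l}. j < lam ! i''}"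
        then show "x \<in> {i<..<i'}"
          using False sorted_ge_nth[OF assms(1), of i' x] by (cases "x < i'") auto
      qed
      then have "?c j \<le> card {i<..<i'}" by (intro card_mono) auto
      then show False
        using eq i' False j assms(2) sorted_ge_nth[OF assms(1), of i i']
        by (simp add: hook nth_degvec)
    qed
    then show ?thesis unfolding H_def D_def by fastforce
  qed
  \<comment> \<open>Counting suffices: \<open>lam ! i\<close> hook lengths and
    \<open>length lam - 1 - i\<close> differences add up to the degree of row
    \<open>i\<close>.\<close>
  show "H \<union> D = {1..?n i}"
  proof (rule card_subset_eq)
    have "hook lam (i, j) \<in> {1..?n i}" if "j < lam ! i" for j
    proof -
      have "1 \<le> lam ! i - j + ?c j \<and> lam ! i - j + ?c j \<le> lam ! i + (?l - 1 - i)"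
        using that c_le[of j] by linarith
      then show ?thesis
        by (simp only: hook[OF that] nth_degvec[OF assms(2)] atLeastAtMost_iff)
    qed
    moreover have "?n i - ?n i' \<in> {1..?n i}" if "i' \<in> {i<..<?l}" for i'
      using lt[of i i'] that by simp
    ultimately show "H \<union> D \<subseteq> {1..?n i}"
      unfolding H_def D_def by auto
    have "card (H \<union> D) = card H + card D"
      using disj by (intro card_Un_disjoint) (auto simp: H_def D_def)
    also have "card H = lam ! i" unfolding H_def by (simp add: card_image[OF inj])
    also have "card D = ?l - 1 - i" unfolding D_def by (simp add: card_image[OF inj'])
    finally show "card (H \<union> D) = card {1..?n i}"
      using assms(2) by (simp add: nth_degvec)
  qed simp
qed

text \<open>\<open>hooks_in_row\<close> restricted to odd numbers and multiplied over all rows;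
  written as a product to stay within \<open>nat\<close>.\<close>

lemma hook_prod_odd_degvec:
  assumes "sorted_wrt (\<ge>) lam"
  shows "hook_prod_odd lam *
      (\<Prod>i<length lam. \<Prod>i' \<in> {i' \<in> {i<..<length lam}. odd (degvec lam ! i - degvec lam ! i')}.
        degvec lam ! i - degvec lam ! i') =
    (\<Prod>i<length lam. odd_fact (degvec lam ! i))"
proof -
  let ?n = "\<lambda>i. degvec lam ! i" and ?l = "length lam"
  have row: "(\<Prod>j\<in>{j \<in> {..<lam ! i}. odd (hook lam (i, j))}. hook lam (i, j)) *
      (\<Prod>i' \<in> {i' \<in> {i<..<?l}. odd (?n i - ?n i')}. ?n i - ?n i') = odd_fact (?n i)"
    if i: "i < ?l" for i
  proof -
    note hooks = hooks_in_row[OF assms i]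
    let ?h = "\<lambda>j. hook lam (i, j)" and ?d = "\<lambda>i'. ?n i - ?n i'"
    let ?J = "{j \<in> {..<lam ! i}. odd (?h j)}" and ?I = "{i' \<in> {i<..<?l}. odd (?d i')}"
    have "(\<Prod>j\<in>?J. ?h j) = \<Prod>(?h ` ?J)"
      by (subst prod.reindex) (auto intro: inj_on_subset[OF hooks(1)])
    moreover have "(\<Prod>i'\<in>?I. ?d i') = \<Prod>(?d ` ?I)"
      by (subst prod.reindex) (auto intro: inj_on_subset[OF hooks(2)])
    moreover have "\<Prod>(?h ` ?J \<union> ?d ` ?I) = \<Prod>(?h ` ?J) * \<Prod>(?d ` ?I)"
      using hooks(3) by (intro prod.union_disjoint) auto
    moreover have "?h ` ?J \<union> ?d ` ?I = {d \<in> {1..?n i}. odd d}"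
      unfolding hooks(4)[symmetric] by auto
    ultimately show ?thesis by (simp add: odd_fact_def)
  qed
  have "{b \<in> young lam. odd (hook lam b)} =
      (SIGMA i:{..<?l}. {j \<in> {..<lam ! i}. odd (hook lam (i, j))})"
    by (auto simp: young_def)
  then have hook_prod: "hook_prod_odd lam =
      (\<Prod>i<?l. \<Prod>j\<in>{j \<in> {..<lam ! i}. odd (hook lam (i, j))}. hook lam (i, j))"
    by (simp add: hook_prod_odd_def prod.Sigma)
  show ?thesis
    unfolding hook_prod prod.distrib[symmetric]
    by (rule prod.cong[OF HOL.refl], rule row, simp)
qed

section \<open>Staircases and padding by zero parts\<close>

lemma length_staircase [simp]: "length (staircase k) = k"
  by (simp add: staircase_def)

lemma nth_staircase: "i < k \<Longrightarrow> staircase k ! i = k - i"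
  by (simp add: staircase_def rev_nth del: upt_Suc)

lemma sum_list_staircase: "sum_list (staircase k) = (\<Sum>i\<le>k. i)"
  by (induction k) (simp_all add: staircase_def)

text \<open>In a staircase the arm of every box equals its leg, so all hook lengths are odd. This is
  why the full hook product of the core appears in the denominator.\<close>

lemma hook_prod_staircase: "hook_prod (staircase k) = hook_prod_odd (staircase k)"
proof -
  have "odd (hook (staircase k) (i, j))" if ij: "(i, j) \<in> young (staircase k)" for i j
  proof -
    have lt: "i < k" "j < k - i" using ij by (auto simp: young_def nth_staircase)
    have "{i' \<in> {i<..<length (staircase k)}. j < staircase k ! i'} = {i<..<k - j}"
      by (auto simp: nth_staircase)
    then have "hook (staircase k) (i, j) = k - i - j + (k - j - i - 1)"
      using lt by (simp add: hook_eq[OF ij] nth_staircase)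
    also have "\<dots> = 2 * (k - j - i - 1) + 1" using lt by simp
    finally show ?thesis by simp
  qed
  then have "{b \<in> young (staircase k). odd (hook (staircase k) b)} = young (staircase k)"
    by auto
  then show ?thesis by (simp add: hook_prod_def hook_prod_odd_def)
qed

lemma young_append_zeros: "young (lam @ replicate z 0) = young lam"
  by (auto simp: young_def nth_append split: if_splits)

text \<open>Zero parts add degrees but no boxes, so the core can be given as many degrees as
  \<open>lam\<close> without affecting its hooks.\<close>

lemma hook_prod_odd_append_zeros: "hook_prod_odd (lam @ replicate z 0) = hook_prod_odd lam"
proof -
  have "hook (lam @ replicate z 0) b = hook lam b" if "b \<in> young lam" for b
    using that by (auto simp: hook_def young_append_zeros) (auto simp: young_def nth_append)
  then show ?thesis
    unfolding hook_prod_odd_def young_append_zeros by (intro prod.cong) auto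
qed

section \<open>The constant coefficient\<close>

lemma Vandermonde_Delta_append:
  "Vandermonde_Delta (xs @ ys) = Vandermonde_Delta xs * Vandermonde_Delta ys *
    (\<Prod>i<length xs. \<Prod>j<length ys. int (ys ! j) - int (xs ! i))"
proof -
  let ?m = "length xs" and ?n = "length ys" and ?z = "\<lambda>i. int ((xs @ ys) ! i)"
  have split: "(\<Prod>t<a + b. f t) = (\<Prod>t<a. f t) * (\<Prod>t<b. f (a + t))"
    for f :: "nat \<Rightarrow> int" and a b
    by (induction b) (simp_all add: mult.assoc)
  have "Vandermonde_Delta (xs @ ys) =
      (\<Prod>j<?m. \<Prod>i<j. ?z j - ?z i) * (\<Prod>j<?n. \<Prod>i<?m + j. ?z (?m + j) - ?z i)"
    by (simp add: Vandermonde_Delta_def split)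
  also have "(\<Prod>j<?m. \<Prod>i<j. ?z j - ?z i) = Vandermonde_Delta xs"
    unfolding Vandermonde_Delta_def by (intro prod.cong) (auto simp: nth_append)
  also have "(\<Prod>j<?n. \<Prod>i<?m + j. ?z (?m + j) - ?z i) =
      (\<Prod>j<?n. (\<Prod>i<?m. int (ys ! j) - int (xs ! i)) * (\<Prod>i<j. int (ys ! j) - int (ys ! i)))"
    unfolding split
    by (intro prod.cong arg_cong2[where f = "(*)"]) (auto simp: nth_append)
  also have "\<dots> = (\<Prod>i<?m. \<Prod>j<?n. int (ys ! j) - int (xs ! i)) * Vandermonde_Delta ys"
    unfolding prod.distrib Vandermonde_Delta_def by (subst prod.swap) (rule HOL.refl)
  finally show ?thesis by (simp add: mult_ac)
qed

lemma Vandermonde_Delta_affine: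
  "Vandermonde_Delta (map (\<lambda>m. 2 * m + p) ms) = (\<Prod>j<length ms. 2 ^ j) * Vandermonde_Delta ms"
proof -
  have "Vandermonde_Delta (map (\<lambda>m. 2 * m + p) ms) =
      (\<Prod>j<length ms. \<Prod>i<j. 2 * (int (ms ! j) - int (ms ! i)))"
    unfolding Vandermonde_Delta_def length_map
    by (intro prod.cong) (auto simp: algebra_simps)
  then show ?thesis
    unfolding prod.distrib Vandermonde_Delta_def by (simp add: prod.distrib)
qed

lemma Vandermonde_Delta_upt: "Vandermonde_Delta [0..<n] = (\<Prod>j<n. fact j)"
proof -
  have "(\<Prod>i<j. int j - int i) = fact j" for j
  proof -
    have "(\<Prod>i<j. int j - int i) = (\<Prod>i<j. int (Suc i))"
      by (subst prod.nat_diff_reindex[symmetric]) (auto intro!: prod.cong simp: of_nat_diff)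
    then show ?thesis by (simp add: fact_prod_Suc atLeast0LessThan)
  qed
  moreover have "Vandermonde_Delta [0..<n] = (\<Prod>j<n. \<Prod>i<j. int j - int i)"
    unfolding Vandermonde_Delta_def by (intro prod.cong) auto
  ultimately show ?thesis by simp
qed

text \<open>The value at \<open>0\<close> of \<open>R\<close> is a quotient of two values of this function: at the set of degrees of
  the partition and at the corresponding set for its core.\<close>

definition parity_ratio :: "nat set \<Rightarrow> real" where
  "parity_ratio N = (\<Prod>n\<in>N. herm_weight n) /
    (\<Prod>a\<in>{a \<in> N. even a}. \<Prod>b\<in>{b \<in> N. odd b}. real b - real a)"

lemma prod_list_nth_set:
  assumes "distinct xs"
  shows "(\<Prod>i<length xs. f (xs ! i)) = (\<Prod>x\<in>set xs. f x)"
proof -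
  have "bij_betw (\<lambda>i. xs ! i) {..<length xs} (set xs)"
    using bij_betw_nth[OF assms] by simp
  then show ?thesis by (rule prod.reindex_bij_betw)
qed

lemma parity_ratio_lists:
  assumes "distinct ms" "distinct ms'"
  shows "parity_ratio (set (map (\<lambda>m. 2 * m) ms @ map (\<lambda>m. 2 * m + 1) ms')) =
    (\<Prod>j<length ms. herm_weight (2 * ms ! j)) * (\<Prod>j<length ms'. herm_weight (2 * ms' ! j + 1)) /
    (\<Prod>i<length ms. \<Prod>j<length ms'. real (2 * ms' ! j + 1) - real (2 * ms ! i))"
proof -
  let ?N = "set (map (\<lambda>m. 2 * m) ms @ map (\<lambda>m. 2 * m + 1) ms')"
  have N: "?N = (\<lambda>m. 2 * m) ` set ms \<union> (\<lambda>m. 2 * m + 1) ` set ms'" by simp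
  have even: "{a \<in> ?N. even a} = (\<lambda>m. 2 * m) ` set ms"
    and odd: "{a \<in> ?N. odd a} = (\<lambda>m. 2 * m + 1) ` set ms'"
    unfolding N by auto
  have inj: "inj_on (\<lambda>m :: nat. 2 * m) A" "inj_on (\<lambda>m :: nat. 2 * m + 1) A" for A
    by (auto simp: inj_on_def)
  have "(\<Prod>n\<in>?N. herm_weight n) =
      (\<Prod>n\<in>(\<lambda>m. 2 * m) ` set ms. herm_weight n) * (\<Prod>n\<in>(\<lambda>m. 2 * m + 1) ` set ms'. herm_weight n)"
    unfolding N by (rule prod.union_disjoint) (auto, presburger)
  then show ?thesis
    unfolding parity_ratio_def even odd prod.reindex[OF inj(1)] prod.reindex[OF inj(2)] o_def
    using assms
    by (simp only: prod_list_nth_set[where f = "\<lambda>m. herm_weight (2 * m)"]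
      prod_list_nth_set[where f = "\<lambda>m. herm_weight (2 * m + 1)"]
      prod_list_nth_set[where f = "\<lambda>m. real (2 * m + 1) - c" for c]
      prod_list_nth_set[where f = "\<lambda>m. \<Prod>x\<in>set ms'. real (2 * x + 1) - real (2 * m)"])
qed

lemma odd_fact_Suc: "odd_fact (Suc n) = (if even n then Suc n * odd_fact n else odd_fact n)"
proof -
  have "{d \<in> {1..Suc n}. odd d} =
      (if even n then insert (Suc n) {d \<in> {1..n}. odd d} else {d \<in> {1..n}. odd d})"
    by (auto simp: le_Suc_eq)
  then show ?thesis by (auto simp: odd_fact_def)
qed

text \<open>The even factors of \<open>(2m)!\<close> and of \<open>(2m+1)!\<close> are
  \<open>2, 4, ..., 2m\<close>, with product \<open>2^m m!\<close>.\<close>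

lemma odd_fact_eq: "odd_fact (2 * m) * (2 ^ m * fact m) = fact (2 * m) \<and>
    odd_fact (2 * m + 1) * (2 ^ m * fact m) = fact (2 * m + 1)"
proof (induction m)
  case 0
  show ?case by (simp add: odd_fact_Suc) (simp add: odd_fact_def)
next
  case (Suc m)
  have "odd_fact (2 * Suc m) = odd_fact (2 * m + 1)"
    by (simp add: odd_fact_Suc)
  then have even: "odd_fact (2 * Suc m) * (2 ^ Suc m * fact (Suc m)) = fact (2 * Suc m)"
  proof -
    assume "odd_fact (2 * Suc m) = odd_fact (2 * m + 1)"
    then have "odd_fact (2 * Suc m) * (2 ^ Suc m * fact (Suc m)) =
        (2 * m + 2) * (odd_fact (2 * m + 1) * (2 ^ m * fact m))"
      by (simp add: algebra_simps)
    also have "\<dots> = fact (2 * Suc m)"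
      unfolding conjunct2[OF Suc] by (simp add: algebra_simps)
    finally show ?thesis .
  qed
  have "odd_fact (2 * Suc m + 1) = (2 * Suc m + 1) * odd_fact (2 * Suc m)"
    using odd_fact_Suc[of "2 * Suc m"] by simp
  then have "odd_fact (2 * Suc m + 1) * (2 ^ Suc m * fact (Suc m)) =
      (2 * Suc m + 1) * fact (2 * Suc m)"
    unfolding even[symmetric] by (simp only: mult.assoc)
  then show ?case using even by simp
qed

text \<open>The denominators \<open>m!\<close> and \<open>2^m\<close> of the weight remove precisely
  the even factors of \<open>n!\<close>; this is the origin of the odd hook lengths.\<close>

lemma herm_weight_eq: "herm_weight n = (-1) ^ (n div 2) * real (odd_fact n)"
proof -
  define m where "m = n div 2"
  have "n = 2 * m \<or> n = 2 * m + 1" unfolding m_def by presburger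
  then have "odd_fact n * (2 ^ m * fact m) = fact n" using odd_fact_eq[of m] by blast
  then have "real (odd_fact n) * (2 ^ m * fact m) = fact n"
    by (metis of_nat_fact of_nat_mult of_nat_numeral of_nat_power)
  then have "fact n / fact m = real (odd_fact n) * 2 ^ m" by (simp add: field_simps)
  moreover have "(- 1 / 2 :: real) ^ m = (-1) ^ m / 2 ^ m"
    by (rule power_divide)
  ultimately show ?thesis unfolding herm_weight_def m_def[symmetric] by simp
qed

lemma sum_card_less:
  "finite A \<Longrightarrow> (\<Sum>j\<in>A. card {i \<in> A. i < j}) = (\<Sum>t<card (A :: nat set). t)"
proof (induction A rule: finite_linorder_max_induct)
  case (insert b A)
  have "b \<notin> A" using insert by auto
  moreover have "{i \<in> insert b A. i < b} = A" using insert by auto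
  moreover have "{i \<in> insert b A. i < j} = {i \<in> A. i < j}" if "j \<in> A" for j
    using insert that by (auto dest: less_asym)
  ultimately show ?case using insert by simp
qed simp

text \<open>An odd difference is one between degrees of opposite parity, so up to sign the
  denominator is the product of odd differences, and \<open>hook_prod_odd_degvec\<close> cancels it.
  Degrees decrease, so a factor "odd minus even" is negative exactly when the even degree comes
  earlier; the weights supply the other sign.\<close>

lemma parity_ratio_degvec:
  fixes lam :: "nat list"
  defines "n \<equiv> \<lambda>i. degvec lam ! i" and "l \<equiv> length lam"
  assumes "sorted_wrt (\<ge>) lam"
  shows "parity_ratio (set (degvec lam)) =
    (-1) ^ ((\<Sum>i<l. n i div 2) + card {(i, j). i < j \<and> j < l \<and> even (n i) \<and> odd (n j)}) *
    real (hook_prod_odd lam)"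
proof -
  note dist = distinct_degvec[OF assms(3)]
  have lt: "n j < n i" if "i < j" "j < l" for i j
    using degvec_strict_antimono[OF assms(3)] that by (simp add: n_def l_def)
  then have le: "\<not> n i < n j" if "i < j" "j < l" for i j
    using that by (meson less_asym)
  define P1 where "P1 = {(i, j). i < j \<and> j < l \<and> even (n i) \<and> odd (n j)}"
  define P2 where "P2 = {(i, j). i < j \<and> j < l \<and> odd (n i) \<and> even (n j)}"
  define T where "T = {(i, j). i < j \<and> j < l \<and> odd (n i - n j)}"
  have fin: "finite P1" "finite P2"
    by (rule finite_subset[of _ "{..<l} \<times> {..<l}"]; auto simp: P1_def P2_def)+
  have T: "T = P1 \<union> P2" "P1 \<inter> P2 = {}"
    using le by (auto simp: T_def P1_def P2_def)
  have bij: "bij_betw n {..<l} (set (degvec lam))"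
    unfolding n_def l_def using bij_betw_nth[OF dist] by simp
  have sub: "bij_betw n {i \<in> {..<l}. Q (n i)} {a \<in> set (degvec lam). Q a}" for Q
    using bij by (auto simp: bij_betw_def inj_on_def)
  have "(\<Prod>a\<in>{a \<in> set (degvec lam). even a}. \<Prod>b\<in>{b \<in> set (degvec lam). odd b}. real b - real a) =
      (\<Prod>i\<in>{i \<in> {..<l}. even (n i)}. \<Prod>j\<in>{j \<in> {..<l}. odd (n j)}. real (n j) - real (n i))"
    unfolding prod.reindex_bij_betw[OF sub[of even], symmetric]
      prod.reindex_bij_betw[OF sub[of odd], symmetric] by (rule HOL.refl)
  also have "\<dots> = (\<Prod>(i, j)\<in>{i \<in> {..<l}. even (n i)} \<times> {j \<in> {..<l}. odd (n j)}.
      real (n j) - real (n i))"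
    by (rule prod.cartesian_product)
  also have "{i \<in> {..<l}. even (n i)} \<times> {j \<in> {..<l}. odd (n j)} = P1 \<union> prod.swap ` P2"
  proof -
    have "i \<noteq> j" if "even (n i)" "odd (n j)" for i j using that by auto
    then show ?thesis by (force simp: P1_def P2_def image_iff neq_iff)
  qed
  also have "(\<Prod>(i, j)\<in>P1 \<union> prod.swap ` P2. real (n j) - real (n i)) =
      (\<Prod>(i, j)\<in>P1. real (n j) - real (n i)) *
      (\<Prod>(i, j)\<in>prod.swap ` P2. real (n j) - real (n i))"
    using fin by (intro prod.union_disjoint) (auto simp: P1_def P2_def)
  also have "(\<Prod>(i, j)\<in>prod.swap ` P2. real (n j) - real (n i)) =
      (\<Prod>(i, j)\<in>P2. real (n i - n j))"
    by (subst prod.reindex) (auto intro!: prod.cong simp: P2_def less_imp_le[OF lt] of_nat_diff)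
  also have "(\<Prod>(i, j)\<in>P1. real (n j) - real (n i)) = (\<Prod>(i, j)\<in>P1. - 1 * real (n i - n j))"
    by (auto intro!: prod.cong simp: P1_def less_imp_le[OF lt] of_nat_diff)
  also have "\<dots> = (-1) ^ card P1 * (\<Prod>(i, j)\<in>P1. real (n i - n j))"
    unfolding split_def prod.distrib by simp
  also have "\<dots> * (\<Prod>(i, j)\<in>P2. real (n i - n j)) =
      (-1) ^ card P1 * (\<Prod>(i, j)\<in>T. real (n i - n j))"
    unfolding T(1) using T(2) fin by (simp add: prod.union_disjoint)
  also have "(\<Prod>(i, j)\<in>T. real (n i - n j)) =
      real (\<Prod>i<l. \<Prod>j\<in>{j \<in> {i<..<l}. odd (n i - n j)}. n i - n j)"
  proof -
    have "T = (SIGMA i:{..<l}. {j \<in> {i<..<l}. odd (n i - n j)})" by (auto simp: T_def)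
    then show ?thesis by (simp add: prod.Sigma split_def)
  qed
  finally have denom: "(\<Prod>a\<in>{a \<in> set (degvec lam). even a}.
      \<Prod>b\<in>{b \<in> set (degvec lam). odd b}. real b - real a) =
    (-1) ^ card P1 * real (\<Prod>i<l. \<Prod>j\<in>{j \<in> {i<..<l}. odd (n i - n j)}. n i - n j)"
    (is "_ = _ * real ?d") .
  have num: "(\<Prod>a\<in>set (degvec lam). herm_weight a) =
      (-1) ^ (\<Sum>i<l. n i div 2) * real (\<Prod>i<l. odd_fact (n i))"
    unfolding prod.reindex_bij_betw[OF bij, symmetric] herm_weight_eq
    by (simp add: prod.distrib power_sum)
  have "?d \<noteq> 0" using lt by auto
  then have nonzero: "real ?d \<noteq> 0" unfolding of_nat_eq_0_iff .
  have "hook_prod_odd lam * ?d = (\<Prod>i<l. odd_fact (n i))"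
    unfolding n_def l_def by (rule hook_prod_odd_degvec[OF assms(3)])
  then have hooks: "real (\<Prod>i<l. odd_fact (n i)) = real (hook_prod_odd lam) * real ?d"
    by (simp only: flip: of_nat_mult)
  have cancel: "a * (h * x) / ((-1) ^ c * x) = a * (-1) ^ c * h"
    if "x \<noteq> 0" for a h x :: real and c :: nat
    using that by (cases "even c") auto
  show ?thesis
    unfolding parity_ratio_def denom num P1_def[symmetric] power_add hooks
    by (rule cancel[OF nonzero])
qed

text \<open>For an odd degree at position \<open>j\<close>, the earlier even and the earlier odd
  positions number \<open>j\<close> together. Hence inversions plus pairs of odd positions make up
  the sum of the positions of odd degrees, which is congruent to the sum of all
  \<open>i * n i\<close>. Between \<open>lam\<close> and its padded core everything cancels but the
  inversions and the row sums tracked by \<open>domino_seq_parity\<close>.\<close>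

lemma card_inversions_parity:
  fixes lam :: "nat list"
  defines "n \<equiv> \<lambda>i. degvec lam ! i" and "l \<equiv> length lam"
  shows "even (card {(i, j). i < j \<and> j < l \<and> even (n i) \<and> odd (n j)} +
    (\<Sum>t<card {i. i < l \<and> odd (n i)}. t) + (\<Sum>i<l. i * lam ! i) + (\<Sum>i<l. i * (l - 1 - i)))"
proof -
  let ?P = "{(i, j). i < j \<and> j < l \<and> even (n i) \<and> odd (n j)}" and ?O = "{i. i < l \<and> odd (n i)}"
  have "?P = prod.swap ` (SIGMA j:?O. {i. i < j \<and> even (n i)})"
    by (auto simp: image_iff)
  then have "card ?P = card (SIGMA j:?O. {i. i < j \<and> even (n i)})"
    by (simp add: card_image)
  also have "\<dots> = (\<Sum>j\<in>?O. card {i. i < j \<and> even (n i)})"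
    by (rule card_SigmaI) auto
  finally have P: "card ?P = (\<Sum>j\<in>?O. card {i. i < j \<and> even (n i)})" .
  have "card {i. i < j \<and> even (n i)} + card {i \<in> ?O. i < j} = j" if "j \<in> ?O" for j
  proof -
    have "{i. i < j \<and> even (n i)} \<union> {i \<in> ?O. i < j} = {..<j}" using that by auto
    moreover have "card ({i. i < j \<and> even (n i)} \<union> {i \<in> ?O. i < j}) =
        card {i. i < j \<and> even (n i)} + card {i \<in> ?O. i < j}"
      by (rule card_Un_disjoint) auto
    ultimately show ?thesis by simp
  qed
  then have "card ?P + (\<Sum>t<card ?O. t) = (\<Sum>j\<in>?O. j)"
    unfolding P by (subst sum_card_less[symmetric]) (simp_all flip: sum.distrib)
  also have "(\<Sum>j\<in>?O. j) = (\<Sum>i<l. if odd (n i) then i else 0)"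
    by (rule sum.mono_neutral_cong_left) auto
  finally have "even (card ?P + (\<Sum>t<card ?O. t) + (\<Sum>i<l. i * n i)) \<longleftrightarrow>
      even (\<Sum>i<l. (if odd (n i) then i else 0) + i * n i)"
    by (simp add: sum.distrib)
  moreover have "even (\<Sum>i<l. (if odd (n i) then i else 0) + i * n i)"
    by (rule dvd_sum) auto
  moreover have "(\<Sum>i<l. i * n i) = (\<Sum>i<l. i * lam ! i) + (\<Sum>i<l. i * (l - 1 - i))"
    unfolding sum.distrib[symmetric] n_def l_def
    by (intro sum.cong) (simp_all only: lessThan_iff nth_degvec distrib_left)
  ultimately show ?thesis by (simp add: add.assoc)
qed

section \<open>Maya diagrams\<close>

lemma two_sum_less: "2 * (\<Sum>i<n. i) + n = n * (n :: nat)"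
  by (induction n) (simp_all add: algebra_simps)

lemma maya_shift_maya:
  "maya_shift (maya lam) (int s) = {n. n < 0} \<union> int ` ({..<s} \<union> (\<lambda>m. m + s) ` set (degvec lam))"
proof -
  have "n \<in> maya_shift (maya lam) (int s) \<longleftrightarrow> n - int s \<in> maya lam" for n
    by (force simp: maya_shift_def image_iff)
  moreover have "n - int s \<in> maya lam \<longleftrightarrow>
      n < 0 \<or> n \<in> int ` {..<s} \<or> n \<in> int ` (\<lambda>m. m + s) ` set (degvec lam)" for n
  proof -
    have "n < int s \<longleftrightarrow> n < 0 \<or> n \<in> int ` {..<s}"
      by (auto simp: image_iff intro: bexI[of _ "nat n"])
    moreover have "n - int s \<in> int ` A \<longleftrightarrow> n \<in> int ` (\<lambda>m. m + s) ` A" for A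
      by (force simp: image_iff)
    ultimately show ?thesis by (auto simp: maya_def)
  qed
  ultimately show ?thesis unfolding set_eq_iff by (simp add: image_Un)
qed

lemma maya_interleave:
  "(\<lambda>m. 2 * m) ` ({n :: int. n < 0} \<union> int ` A) \<union> (\<lambda>m. 2 * m + 1) ` ({n. n < 0} \<union> int ` B) =
    {n. n < 0} \<union> int ` ((\<lambda>m. 2 * m) ` A \<union> (\<lambda>m. 2 * m + 1) ` B)"
proof -
  have "n \<in> {n :: int. n < 0} \<longleftrightarrow>
      n \<in> (\<lambda>m. 2 * m) ` {n. n < 0} \<union> (\<lambda>m. 2 * m + 1) ` {n. n < 0}" for n
    unfolding Un_iff image_iff Bex_def mem_Collect_eq by presburger
  then have neg: "(\<lambda>m. 2 * m) ` {n. n < 0} \<union> (\<lambda>m. 2 * m + 1) ` {n. n < 0} = {n :: int. n < 0}"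
    by blast
  have "(\<lambda>m. 2 * m) ` int ` A = int ` (\<lambda>m. 2 * m) ` A"
    "(\<lambda>m. 2 * m + 1) ` int ` B = int ` (\<lambda>m. 2 * m + 1) ` B"
    unfolding image_image by (simp_all add: add.commute)
  then have "(\<lambda>m. 2 * m) ` ({n :: int. n < 0} \<union> int ` A) \<union>
      (\<lambda>m. 2 * m + 1) ` ({n. n < 0} \<union> int ` B) =
    ((\<lambda>m. 2 * m) ` {n. n < 0} \<union> (\<lambda>m. 2 * m + 1) ` {n. n < 0}) \<union>
      int ` ((\<lambda>m. 2 * m) ` A \<union> (\<lambda>m. 2 * m + 1) ` B)"
    unfolding image_Un by (simp only: Un_ac)
  then show ?thesis unfolding neg .
qed

lemma card_less_nth_sorted:
  fixes xs :: "nat list"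
  assumes "sorted_wrt (<) xs" "r < length xs"
  shows "card {x \<in> set xs. x < xs ! r} = r"
proof -
  have "{x \<in> set xs. x < xs ! r} = (\<lambda>i. xs ! i) ` {..<r}"
  proof (intro equalityI subsetI)
    fix x assume "x \<in> {x \<in> set xs. x < xs ! r}"
    then obtain i where i: "i < length xs" "x = xs ! i" "xs ! i < xs ! r"
      by (auto simp: in_set_conv_nth)
    then have "i < r"
      using assms sorted_wrt_nth_less[OF assms(1), of r i]
      by (cases i r rule: linorder_cases) auto
    then show "x \<in> (\<lambda>i. xs ! i) ` {..<r}" using i by blast
  next
    fix x assume "x \<in> (\<lambda>i. xs ! i) ` {..<r}"
    then show "x \<in> {x \<in> set xs. x < xs ! r}"
      using assms sorted_wrt_nth_less[OF assms(1)] by auto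
  qed
  moreover have "inj_on (\<lambda>i. xs ! i) {..<r}"
    using assms by (intro inj_on_nth) (auto simp: strict_sorted_iff)
  ultimately show ?thesis by (simp add: card_image)
qed

text \<open>The hypothesis on \<open>t\<close> says that \<open>t\<close> is the first gap of the Maya diagram.\<close>

lemma set_degvec_maya_partition:
  assumes "finite S" "{..<t} \<subseteq> S" "t \<notin> S"
  shows "set (degvec (maya_partition ({n. n < 0} \<union> int ` S))) = (\<lambda>s. s - t) ` {s \<in> S. t < s}"
proof -
  define M where "M = {n :: int. n < 0} \<union> int ` S"
  define U where "U = {s \<in> S. t < s}"
  define xs where "xs = sorted_list_of_set U"
  define f where "f m = card {n. n \<notin> M \<and> n < m}" for m
  define g where "g u = card {n. n \<notin> S \<and> n < u}" for u
  have finU: "finite U" using assms by (simp add: U_def)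
  have xs: "set xs = U" "distinct xs" "sorted xs" "sorted_wrt (<) xs"
    using finU by (simp_all add: xs_def)
  have f: "f (int u) = g u" for u
  proof -
    have "{n. n \<notin> M \<and> n < int u} = int ` {n. n \<notin> S \<and> n < u}"
    proof (intro equalityI subsetI)
      fix n assume "n \<in> {n. n \<notin> M \<and> n < int u}"
      then have n: "n \<notin> M" "n < int u" by auto
      then have "0 \<le> n" by (simp add: M_def)
      then obtain v where "n = int v" using nonneg_int_cases by blast
      then have "v \<notin> S" "v < u" using n by (auto simp: M_def)
      then show "n \<in> int ` {n. n \<notin> S \<and> n < u}" using \<open>n = int v\<close> by blast
    qed (auto simp: M_def)
    then show ?thesis by (simp add: f_def g_def card_image)
  qed
  have f_neg: "f m = 0" if "m < 0" for m
  proof -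
    have "{n. n \<notin> M \<and> n < m} = {}" using that by (auto simp: M_def)
    then show ?thesis unfolding f_def by (simp only: card.empty)
  qed
  have g_pos: "0 < g u \<longleftrightarrow> t < u" for u
  proof -
    have "finite {n. n \<notin> S \<and> n < u}" by simp
    then have "0 < g u \<longleftrightarrow> {n. n \<notin> S \<and> n < u} \<noteq> {}"
      unfolding g_def by (simp only: card_gt_0_iff simp_thms)
    also have "\<dots> \<longleftrightarrow> t < u"
    proof
      assume "{n. n \<notin> S \<and> n < u} \<noteq> {}"
      then obtain n where "n \<notin> S" "n < u" by blast
      moreover from this have "\<not> n < t" using assms(2) by blast
      ultimately show "t < u" by simp
    next
      assume "t < u"
      then show "{n. n \<notin> S \<and> n < u} \<noteq> {}" using assms(3) by blast
    qed
    finally show ?thesis .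
  qed
  have "{m \<in> M. 0 < f m} = int ` U"
  proof -
    have "m \<in> M \<and> 0 < f m \<longleftrightarrow> m \<in> int ` U" for m
    proof (cases "m < 0")
      case True
      then show ?thesis using f_neg by auto
    next
      case False
      then have "0 \<le> m" by simp
      then obtain u where "m = int u" using nonneg_int_cases by blast
      then show ?thesis by (auto simp: M_def U_def f g_pos)
    qed
    then show ?thesis by blast
  qed
  then have "image_mset f (mset_set {m \<in> M. 0 < f m}) = image_mset f (image_mset int (mset_set U))"
    by (simp add: image_mset_mset_set)
  also have "mset_set U = mset xs"
    using mset_set_set[OF xs(2)] by (simp add: xs(1))
  also have "image_mset f (image_mset int (mset xs)) = mset (map g xs)"
    by (simp add: f multiset.map_comp o_def)
  finally have "maya_partition M = rev (sort (map g xs))"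
    unfolding maya_partition_def Let_def f_def[symmetric, abs_def]
    by (simp add: sorted_list_of_multiset_mset del: mset_map)
  moreover have "sorted (map g xs)"
  proof -
    have "mono g" by (auto intro!: monoI card_mono simp: g_def)
    then show ?thesis using xs(3) by (simp add: sorted_map_mono mono_imp_mono_on)
  qed
  ultimately have lam: "maya_partition M = rev (map g xs)"
    by (simp add: sorted_sort_id)
  \<comment> \<open>The numbers below \<open>xs ! r\<close> are the \<open>g (xs ! r)\<close> gaps,
    the \<open>t\<close> elements before the first gap and \<open>r\<close> elements after it. Part
    plus rank is thus the distance from the first gap, and this is the degree.\<close>
  have g_nth: "g (xs ! r) + r = xs ! r - t" if r: "r < length xs" for r
  proof -
    let ?u = "xs ! r"
    have u: "?u \<in> S" "t < ?u" using xs(1) nth_mem[OF r] by (auto simp: U_def)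
    have "{..<?u} = ({n. n \<notin> S \<and> n < ?u} \<union> {..<t}) \<union> {x \<in> set xs. x < ?u}"
      using assms(2,3) u by (auto simp: xs(1) U_def not_less le_less)
    moreover have "card (({n. n \<notin> S \<and> n < ?u} \<union> {..<t}) \<union> {x \<in> set xs. x < ?u}) =
        card ({n. n \<notin> S \<and> n < ?u} \<union> {..<t}) + card {x \<in> set xs. x < ?u}"
      by (rule card_Un_disjoint) (auto simp: xs(1) U_def)
    moreover have "card ({n. n \<notin> S \<and> n < ?u} \<union> {..<t}) = g ?u + t"
      unfolding g_def using assms(2) by (subst card_Un_disjoint) auto
    ultimately have "card {..<?u} = g ?u + t + r"
      by (simp only: card_less_nth_sorted[OF xs(4) r])
    then show ?thesis by simp
  qed
  have deg: "degvec (maya_partition M) ! i = xs ! (length xs - 1 - i) - t" if "i < length xs" for i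
    using g_nth[of "length xs - 1 - i"] that by (simp add: lam nth_degvec rev_nth)
  have "degvec (maya_partition M) = rev (map (\<lambda>s. s - t) xs)"
    by (rule nth_equalityI) (simp_all add: lam deg[unfolded lam] rev_nth)
  then have "set (degvec (maya_partition M)) = (\<lambda>s. s - t) ` U"
    using xs(1) by simp
  then show ?thesis by (simp add: M_def U_def)
qed

section \<open>Degrees of a partition built from its quotient\<close>

lemma zero_notin_degvec:
  assumes "is_partition lam"
  shows "0 \<notin> set (degvec lam)"
proof
  assume "0 \<in> set (degvec lam)"
  then obtain i where "i < length lam" "degvec lam ! i = 0"
    by (auto simp: in_set_conv_nth)
  then have "lam ! i \<in> set lam" "lam ! i = 0" by (simp_all add: nth_degvec)
  then show False using assms by (auto simp: is_partition_def)
qed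

lemma card_set_degvec: "is_partition lam \<Longrightarrow> card (set (degvec lam)) = length lam"
  using distinct_card[OF distinct_degvec] by (simp add: is_partition_def)

lemma sum_set_degvec:
  "is_partition lam \<Longrightarrow> \<Sum>(set (degvec lam)) = sum_list lam + (\<Sum>i<length lam. i)"
  using sum_list_distinct_conv_sum_set[OF distinct_degvec, of lam "\<lambda>x. x"]
  by (simp add: is_partition_def sum_degvec)

text \<open>The non-negative part of the Maya diagram of \<open>lam\<close> shifted by
  \<open>s\<close>.\<close>

definition charged_degrees :: "nat list \<Rightarrow> nat \<Rightarrow> nat set" where
  "charged_degrees lam s = {..<s} \<union> (\<lambda>m. m + s) ` set (degvec lam)"

lemma finite_charged_degrees: "finite (charged_degrees lam s)"
  by (simp add: charged_degrees_def)

lemma card_charged_degrees: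
  "is_partition lam \<Longrightarrow> card (charged_degrees lam s) = s + length lam"
  unfolding charged_degrees_def
  by (subst card_Un_disjoint) (auto simp: card_image card_set_degvec)

text \<open>With \<open>n = s + length lam\<close>, the elements arise from
  \<open>0, ..., n - 1\<close> by raising them by the parts of \<open>lam\<close>. The identity is
  doubled and the linear term moved to the left to avoid division and subtraction.\<close>

lemma sum_charged_degrees:
  assumes "is_partition lam"
  shows "2 * \<Sum>(charged_degrees lam s) + (s + length lam) =
    2 * sum_list lam + (s + length lam) * (s + length lam)"
proof -
  have "\<Sum>(charged_degrees lam s) = \<Sum>{..<s} + \<Sum>((\<lambda>m. m + s) ` set (degvec lam))"
    unfolding charged_degrees_def by (rule sum.union_disjoint) auto
  also have "\<Sum>((\<lambda>m. m + s) ` set (degvec lam)) = (\<Sum>m\<in>set (degvec lam). m + s)"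
    by (subst sum.reindex) auto
  also have "\<dots> = sum_list lam + (\<Sum>i<length lam. i) + s * length lam"
    by (simp add: sum.distrib sum_set_degvec[OF assms] card_set_degvec[OF assms])
  finally show ?thesis
    using two_sum_less[of s] two_sum_less[of "length lam"] by (simp add: algebra_simps)
qed

text \<open>The degrees of \<open>lam\<close> are the elements of the interleaved set
  \<open>S\<close> beyond its first gap, measured from that gap. The gap is \<open>0\<close> or
  \<open>1\<close>; in the second case measuring from it exchanges the parities and drops the
  element \<open>0\<close>, hence the two alternatives with \<open>k\<close> and
  \<open>k + 1\<close>. The size follows by summing degrees.\<close>

lemma Phi_degrees:
  assumes "is_partition lam" "is_partition mu" "is_partition nu" "lam = Phi mu nu (int k)"
  defines "N \<equiv> set (degvec lam)"
  defines "e \<equiv> card {n \<in> N. even n}" and "o' \<equiv> card {n \<in> N. odd n}"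
  shows "(o' = e + k \<or> e = o' + k + 1) \<and>
    sum_list lam = (\<Sum>i\<le>k. i) + 2 * (sum_list mu + sum_list nu)"
proof -
  define d where "d = int k + int (length mu) - int (length nu)"
  define s where "s = nat (max 0 (- d))"
  define s' where "s' = nat (max 0 d)"
  define A where "A = charged_degrees mu s"
  define B where "B = charged_degrees nu s'"
  define S where "S = (\<lambda>m. 2 * m) ` A \<union> (\<lambda>m. 2 * m + 1) ` B"
  define a where "a = card A"
  define b where "b = card B"
  have fin: "finite A" "finite B" by (simp_all add: A_def B_def finite_charged_degrees)
  have ab: "b = a + k"
    using assms(2,3) unfolding a_def b_def A_def B_def
    by (simp add: card_charged_degrees s_def s'_def d_def)
  have sums: "2 * \<Sum>A + a = 2 * sum_list mu + a * a" "2 * \<Sum>B + b = 2 * sum_list nu + b * b"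
    using sum_charged_degrees[OF assms(2), of s] sum_charged_degrees[OF assms(3), of s']
      card_charged_degrees[OF assms(2), of s] card_charged_degrees[OF assms(3), of s']
    by (simp_all add: A_def B_def a_def b_def)
  have inj: "inj_on (\<lambda>m :: nat. 2 * m) X" "inj_on (\<lambda>m :: nat. 2 * m + 1) X" for X
    by (auto simp: inj_on_def)
  have disj: "(\<lambda>m. 2 * m) ` A \<inter> (\<lambda>m. 2 * m + 1) ` B = {}" by (auto, presburger)
  have finS: "finite S" using fin by (simp add: S_def)
  have evenS: "{n \<in> S. even n} = (\<lambda>m. 2 * m) ` A" and oddS: "{n \<in> S. odd n} = (\<lambda>m. 2 * m + 1) ` B"
    by (auto simp: S_def)
  have cardS: "card S = a + b"
    unfolding S_def a_def b_def card_image[OF inj(1), of A, symmetric]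
      card_image[OF inj(2), of B, symmetric]
    using fin by (intro card_Un_disjoint disj) auto
  have sumS: "\<Sum>S = 2 * \<Sum>A + 2 * \<Sum>B + b"
    unfolding S_def b_def using fin
    by (subst sum.union_disjoint[OF _ _ disj])
      (simp_all add: sum.reindex inj[simplified] sum_distrib_left sum.distrib sum_Suc)
  have lam: "lam = maya_partition ({n. n < 0} \<union> int ` S)"
  proof -
    have "max 0 (- d) = int s" "max 0 d = int s'" by (simp_all add: s_def s'_def)
    then have "lam = maya_partition ((\<lambda>m. 2 * m) ` maya_shift (maya mu) (int s) \<union>
        (\<lambda>m. 2 * m + 1) ` maya_shift (maya nu) (int s'))"
      unfolding assms(4) Phi_def Let_def d_def[symmetric] by simp
    then show ?thesis
      unfolding maya_shift_maya maya_interleave S_def A_def B_def charged_degrees_def .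
  qed
  have zero_A: "0 \<in> A \<longleftrightarrow> 0 < s" and zero_B: "0 \<in> B \<longleftrightarrow> 0 < s'"
    using zero_notin_degvec[OF assms(2)] zero_notin_degvec[OF assms(3)]
    by (auto simp: A_def B_def charged_degrees_def)
  have cardN: "card N = length lam" unfolding N_def by (rule card_set_degvec[OF assms(1)])
  have sumN: "2 * \<Sum>N + length lam = 2 * sum_list lam + length lam * length lam"
    unfolding N_def sum_set_degvec[OF assms(1)] using two_sum_less[of "length lam"] by simp
  have k: "2 * (\<Sum>i\<le>k. i) = k * k + k"
    using two_sum_less[of "Suc k"] by (simp add: lessThan_Suc_atMost)
  show ?thesis
  proof (cases "s = 0")
    case True
    then have "0 \<notin> S" using zero_A by (auto simp: S_def)
    then have N: "N = S"
      unfolding N_def lam by (subst set_degvec_maya_partition[OF finS, of 0]) (auto intro!: gr0I)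
    have "e = a" "o' = b"
      unfolding e_def o'_def N evenS oddS a_def b_def
      by (rule card_image[OF inj(1)], rule card_image[OF inj(2)])
    moreover have "2 * (2 * \<Sum>A + 2 * \<Sum>B + b) + (a + b) = 2 * sum_list lam + (a + b) * (a + b)"
      using sumN unfolding cardN[symmetric] unfolding N cardS sumS .
    then have "2 * sum_list lam = 2 * ((\<Sum>i\<le>k. i) + 2 * (sum_list mu + sum_list nu))"
      using sums k unfolding ab by (simp add: algebra_simps)
    ultimately show ?thesis using ab by simp
  next
    case False
    \<comment> \<open>\<open>s\<close> and \<open>s'\<close> are the negative and positive part of
      one integer, so at most one is non-zero; and \<open>1 \<in> S\<close> would mean
      \<open>0 \<in> B\<close>, impossible since degrees of a partition are positive.\<close>
    then have "s' = 0" by (auto simp: s_def s'_def)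
    then have S01: "0 \<in> S" "1 \<notin> S" using False zero_A zero_B by (auto simp: S_def)
    have N: "N = (\<lambda>s. s - 1) ` (S - {0})"
    proof -
      have "{s \<in> S. 1 < s} = S - {0}" using S01 by (auto simp: less_Suc_eq) (metis One_nat_def Suc_lessI gr0I)
      then show ?thesis
        unfolding N_def lam using S01 by (subst set_degvec_maya_partition[OF finS, of 1]) auto
    qed
    have injN: "inj_on (\<lambda>s. s - 1) (X - {0 :: nat})" for X by (auto simp: inj_on_def)
    have "{n \<in> N. even n} = (\<lambda>s. s - 1) ` ({n \<in> S. odd n} - {0})"
      "{n \<in> N. odd n} = (\<lambda>s. s - 1) ` ({n \<in> S. even n} - {0})"
      unfolding N by auto
    then have "e = card ({n \<in> S. odd n} - {0})" "o' = card ({n \<in> S. even n} - {0})"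
      unfolding e_def o'_def by (simp_all only: card_image[OF injN])
    moreover have "{n \<in> S. odd n} - {0} = {n \<in> S. odd n}" "0 \<in> {n \<in> S. even n}"
      using S01 by auto
    ultimately have eo: "e = b" "o' = a - 1"
      unfolding evenS oddS a_def b_def
      using card_image[OF inj(1), of A] card_image[OF inj(2), of B] by simp_all
    have "0 < a" using zero_A False fin unfolding a_def by (auto simp: card_gt_0_iff)
    then obtain a' where a: "a = Suc a'" by (cases a) auto
    have N_card: "card N = a' + b"
      unfolding N card_image[OF injN] using S01 finS cardS a by simp
    have "\<Sum>N + card N = (\<Sum>s\<in>S - {0}. s - 1) + (\<Sum>s\<in>S - {0}. 1)"
      unfolding N card_image[OF injN] sum.reindex[OF injN] o_def id_def by simp
    also have "\<dots> = \<Sum>(S - {0})"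
      unfolding sum.distrib[symmetric] by (rule sum.cong) auto
    also have "\<dots> = \<Sum>S" using finS by (simp add: sum_diff1_nat)
    finally have N_sum: "\<Sum>N + (a' + b) = 2 * \<Sum>A + 2 * \<Sum>B + b"
      unfolding N_card sumS .
    have "2 * sum_list lam = 2 * ((\<Sum>i\<le>k. i) + 2 * (sum_list mu + sum_list nu))"
      using sums k N_sum sumN unfolding cardN[symmetric] N_card ab a by (simp add: algebra_simps)
    then show ?thesis using eo ab a by simp
  qed
qed

section \<open>The main theorem\<close>

lemma sorted_staircase_zeros: "sorted_wrt (\<ge>) (staircase k @ replicate z 0)"
  by (auto simp: sorted_wrt_iff_nth_less nth_append nth_staircase)

lemma mem_interleaved_upt:
  "x \<in> set (map (\<lambda>i. 2 * i) [0..<e] @ map (\<lambda>i. 2 * i + 1) [0..<d]) \<longleftrightarrow>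
    (even x \<and> x < 2 * e) \<or> (odd x \<and> x < 2 * d)"
proof (cases "even x")
  case True
  then obtain y where "x = 2 * y" by blast
  moreover have "2 * y \<noteq> Suc (2 * i)" for i by presburger
  ultimately show ?thesis by auto
next
  case False
  then obtain y where "x = 2 * y + 1" by (rule oddE)
  moreover have "Suc (2 * y) \<noteq> 2 * i" for i by presburger
  ultimately show ?thesis by auto
qed

text \<open>The zero rows give an initial interval of degrees, the rows of the staircase continue it
  in steps of two, with odd degrees in the first alternative and even ones in the second. One
  inclusion and equal cardinalities suffice.\<close>

lemma set_degvec_staircase_zeros:
  assumes "d = e + k \<or> e = d + k + 1"
  shows "set (degvec (staircase k @ replicate (e + d - k) 0)) =
    set (map (\<lambda>i. 2 * i) [0..<e] @ map (\<lambda>i. 2 * i + 1) [0..<d])"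
    (is "set (degvec ?core) = set ?as")
proof (rule card_subset_eq)
  have len: "length ?core = e + d" using assms by auto
  have "distinct ?as" by (auto simp: distinct_map inj_on_def) presburger+
  then have "card (set ?as) = e + d" by (simp add: distinct_card del: set_append set_map)
  then show "card (set (degvec ?core)) = card (set ?as)"
    using distinct_card[OF distinct_degvec[OF sorted_staircase_zeros]] len by simp
  show "set (degvec ?core) \<subseteq> set ?as"
  proof
    fix x assume "x \<in> set (degvec ?core)"
    then obtain i where i: "i < e + d" "x = ?core ! i + (e + d - 1 - i)"
      unfolding in_set_conv_nth length_degvec len by (metis len nth_degvec)
    show "x \<in> set ?as"
    proof (cases "i < k")
      case True
      then have x: "x = (k - i) + (e + d - 1 - i)"
        using i by (simp add: nth_append nth_staircase)
      from assms show ?thesis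
      proof
        assume d: "d = e + k"
        then have "x = 2 * (e + k - 1 - i) + 1" "e + k - 1 - i < d" using x True by linarith+
        then show ?thesis unfolding mem_interleaved_upt by simp
      next
        assume e: "e = d + k + 1"
        then have "x = 2 * (d + k - i)" "d + k - i < e" using x True by linarith+
        then show ?thesis unfolding mem_interleaved_upt by simp
      qed
    next
      case False
      then have x: "x = e + d - 1 - i"
        using i len by (simp add: nth_append)
      from assms show ?thesis
      proof
        assume d: "d = e + k"
        then have "x < 2 * e" "x < 2 * d" using x False i(1) by linarith+
        then show ?thesis unfolding mem_interleaved_upt by simp
      next
        assume e: "e = d + k + 1"
        \<comment> \<open>There are \<open>2 * d + 1\<close> zero rows here, so the interval ends at
          \<open>2 * d\<close>, which is accounted for as an even degree below
          \<open>2 * e\<close>.\<close>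
        then have "x \<le> 2 * d" "x < 2 * e" using x False i(1) by linarith+
        then show ?thesis unfolding mem_interleaved_upt by (cases "x = 2 * d") auto
      qed
    qed
  qed
qed simp

text \<open>The powers of two and the Vandermonde products of \<open>ms\<close> and
  \<open>ms'\<close> cancel, as do the factorials, which are the Vandermonde products of
  \<open>[0..<length ms]\<close> and \<open>[0..<length ms']\<close>. Only weights and differences
  of opposite parity remain; this dictates the shape of \<open>parity_ratio\<close>.\<close>

lemma Wronskian_value_eq_parity_ratio:
  fixes ms ms' :: "nat list"
  defines "as \<equiv> map (\<lambda>i. 2 * i) [0..<length ms] @ map (\<lambda>i. 2 * i + 1) [0..<length ms']"
    and "ns \<equiv> map (\<lambda>m. 2 * m) ms @ map (\<lambda>m. 2 * m + 1) ms'"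
  assumes "distinct ms" "distinct ms'"
  shows "real_of_int (Vandermonde_Delta as) *
      ((\<Prod>j<length ms. herm_weight (2 * ms ! j) / (herm_weight (2 * j) * fact j)) *
        real_of_int (Vandermonde_Delta ms)) *
      ((\<Prod>j<length ms'. herm_weight (2 * ms' ! j + 1) / (herm_weight (2 * j + 1) * fact j)) *
        real_of_int (Vandermonde_Delta ms')) / real_of_int (Vandermonde_Delta ns) =
    parity_ratio (set ns) / parity_ratio (set as)"
proof -
  let ?e = "length ms" and ?o = "length ms'"
  define X where "X = (\<Prod>i<?e. \<Prod>j<?o. real (2 * ms' ! j + 1) - real (2 * ms ! i))"
  define X0 where "X0 = (\<Prod>i<?e. \<Prod>j<?o. real (2 * j + 1) - real (2 * i))"
  define p where "p n = (\<Prod>j<n. 2 ^ j :: real)" for n :: nat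
  define F where "F n = (\<Prod>j<n. fact j :: real)" for n :: nat
  define u where "u = (\<Prod>j<?e. herm_weight (2 * ms ! j))"
  define u' where "u' = (\<Prod>j<?o. herm_weight (2 * ms' ! j + 1))"
  define w where "w = (\<Prod>j<?e. herm_weight (2 * j))"
  define w' where "w' = (\<Prod>j<?o. herm_weight (2 * j + 1))"
  define V where "V = real_of_int (Vandermonde_Delta ms)"
  define V' where "V' = real_of_int (Vandermonde_Delta ms')"
  have neq: "real (2 * a + 1) - real (2 * b) \<noteq> 0" for a b :: nat
    unfolding right_minus_eq of_nat_eq_iff by presburger
  have affine0: "Vandermonde_Delta (map (\<lambda>m. 2 * m) xs) =
      (\<Prod>j<length xs. 2 ^ j) * Vandermonde_Delta xs" for xs
    using Vandermonde_Delta_affine[of 0 xs] by simp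
  have affine1: "Vandermonde_Delta (map (\<lambda>m. Suc (2 * m)) xs) =
      (\<Prod>j<length xs. 2 ^ j) * Vandermonde_Delta xs" for xs
    using Vandermonde_Delta_affine[of 1 xs] by simp
  have nz: "X \<noteq> 0" "X0 \<noteq> 0" "p n \<noteq> 0" "F n \<noteq> 0" "w \<noteq> 0" "w' \<noteq> 0" "u \<noteq> 0" "u' \<noteq> 0" "V \<noteq> 0" "V' \<noteq> 0" for n
    using neq Vandermonde_Delta_nonzero assms
    by (auto simp: X_def X0_def p_def F_def w_def w'_def u_def u'_def V_def V'_def herm_weight_nonzero
        simp del: of_nat_add of_nat_mult of_nat_Suc)
  have Vns: "real_of_int (Vandermonde_Delta ns) = p ?e * V * (p ?o * V') * X"
    by (simp add: ns_def Vandermonde_Delta_append affine0 affine1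
        p_def V_def V'_def X_def)
  have Vas: "real_of_int (Vandermonde_Delta as) = p ?e * F ?e * (p ?o * F ?o) * X0"
    by (simp add: as_def Vandermonde_Delta_append affine0 affine1
        Vandermonde_Delta_upt p_def F_def X0_def)
  have Pns: "parity_ratio (set ns) = u * u' / X"
    unfolding ns_def u_def u'_def X_def by (rule parity_ratio_lists[OF assms(3,4)])
  have Pas: "parity_ratio (set as) = w * w' / X0"
    using parity_ratio_lists[of "[0..<?e]" "[0..<?o]"]
    by (simp add: as_def w_def w'_def X0_def)
  have weights: "(\<Prod>j<?e. herm_weight (2 * ms ! j) / (herm_weight (2 * j) * fact j)) = u / (w * F ?e)"
    "(\<Prod>j<?o. herm_weight (2 * ms' ! j + 1) / (herm_weight (2 * j + 1) * fact j)) = u' / (w' * F ?o)"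
    by (simp_all add: u_def w_def u'_def w'_def F_def prod_dividef prod.distrib)
  show ?thesis
    unfolding V_def[symmetric] V'_def[symmetric] Vns Vas Pns Pas weights
    using nz by (simp add: field_simps)
qed

text \<open>Twice the sum of the halved degrees differs from the sum of all degrees by the number of
  odd ones, which is common to both lists, so the halves differ by \<open>m\<close>. The inversions
  differ in parity by \<open>v\<close>, by \<open>card_inversions_parity\<close>.\<close>

lemma parity_ratio_quotient:
  assumes "sorted_wrt (\<ge>) lam" "sorted_wrt (\<ge>) core" "length core = length lam"
    and "card {a \<in> set (degvec lam). odd a} = card {a \<in> set (degvec core). odd a}"
    and "sum_list lam = sum_list core + 2 * m"
    and "even (v + (\<Sum>i<length lam. i * lam ! i) + (\<Sum>i<length core. i * core ! i))"
  shows "parity_ratio (set (degvec lam)) / parity_ratio (set (degvec core)) =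
    (-1) ^ (v + m) * real (hook_prod_odd lam) / real (hook_prod_odd core)"
proof -
  let ?l = "length lam"
  let ?inv = "\<lambda>xs :: nat list. card {(i, j). i < j \<and> j < length xs \<and>
    even (degvec xs ! i) \<and> odd (degvec xs ! j)}"
  let ?half = "\<lambda>xs :: nat list. \<Sum>i<length xs. degvec xs ! i div 2"
  have odd_card: "card {i. i < length xs \<and> odd (degvec xs ! i)} =
      card {a \<in> set (degvec xs). odd a}" if "sorted_wrt (\<ge>) xs" for xs :: "nat list"
  proof -
    have "inj_on (\<lambda>i. degvec xs ! i) {i. i < length xs \<and> odd (degvec xs ! i)}"
      by (rule inj_on_nth[OF distinct_degvec[OF that]]) simp
    moreover have "(\<lambda>i. degvec xs ! i) ` {i. i < length xs \<and> odd (degvec xs ! i)} =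
        {a \<in> set (degvec xs). odd a}"
      by (auto simp: in_set_conv_nth)
    ultimately show ?thesis using card_image by fastforce
  qed
  have half: "2 * ?half xs + card {a \<in> set (degvec xs). odd a} =
      sum_list xs + (\<Sum>i<length xs. i)" if "sorted_wrt (\<ge>) xs" for xs
  proof -
    have "card {a \<in> set (degvec xs). odd a} = (\<Sum>i<length xs. degvec xs ! i mod 2)"
    proof -
      have "(\<Sum>i<length xs. degvec xs ! i mod 2) =
          (\<Sum>i\<in>{i. i < length xs \<and> odd (degvec xs ! i)}. 1)"
        by (rule sum.mono_neutral_cong_right) (auto simp: odd_iff_mod_2_eq_one)
      then show ?thesis using odd_card[OF that] by simp
    qed
    then have "2 * ?half xs + card {a \<in> set (degvec xs). odd a} = (\<Sum>i<length xs. degvec xs ! i)"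
      by (simp add: sum_distrib_left flip: sum.distrib)
    also have "\<dots> = sum_list (degvec xs)"
      by (simp add: sum_list_sum_nth atLeast0LessThan)
    finally show ?thesis by (simp add: sum_degvec)
  qed
  have odd_core: "card {i. i < length lam \<and> odd (degvec core ! i)} =
      card {a \<in> set (degvec core). odd a}"
    using odd_card[OF assms(2)] unfolding assms(3) .
  have "?half lam = ?half core + m"
    using half[OF assms(1)] half[OF assms(2)] assms(3-5) by simp
  moreover have "even (?inv lam + ?inv core + v)"
    using card_inversions_parity[of lam] card_inversions_parity[of core] assms(6)
    unfolding assms(3) odd_card[OF assms(1)] odd_core assms(4) even_add by blast
  ultimately have "even ((?half lam + ?inv lam) + (?half core + ?inv core) + (v + m))"
    by presburger
  then have sign: "(-1 :: real) ^ (?half lam + ?inv lam) / (-1) ^ (?half core + ?inv core) =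
      (-1) ^ (v + m)"
    by (auto simp: minus_one_power_iff)
  show ?thesis
    unfolding parity_ratio_degvec[OF assms(1)] parity_ratio_degvec[OF assms(2)] sign[symmetric]
    by simp
qed

theorem theorem3p1:
  fixes lam mu nu :: "nat list" and k :: nat
  assumes "is_partition lam" and "is_partition mu" and "is_partition nu"
    and "lam = Phi mu nu (int k)"
  shows "\<exists>R :: real poly.
           lead_coeff R = 1 \<and> degree R = sum_list mu + sum_list nu \<and>
           WHermite lam = monom 1 (sum_list (staircase k)) * pcompose R [:0, 0, 1:] \<and>
           poly R 0 \<noteq> 0 \<and>
           (\<forall>v. domino_seq lam (staircase k) v \<longrightarrow>
              poly R 0 = (-1) ^ (v + (sum_list lam - sum_list (staircase k)) div 2)
                         * real (hook_prod_odd lam) / real (hook_prod (staircase k)))"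
proof -
  let ?X = "[:0, 0, 1:] :: real poly" and ?V = "\<lambda>xs. real_of_int (Vandermonde_Delta xs)"
  let ?c = "sum_list (staircase k)" and ?m = "sum_list mu + sum_list nu"
  have sorted: "sorted_wrt (\<ge>) lam" using assms(1) by (simp add: is_partition_def)
  define ns where "ns = degvec lam"
  define ms where "ms = map (\<lambda>n. n div 2) (filter even ns)"
  define ms' where "ms' = map (\<lambda>n. n div 2) (filter odd ns)"
  define ns' where "ns' = map (\<lambda>m. 2 * m) ms @ map (\<lambda>m. 2 * m + 1) ms'"
  define e where "e = length ms"
  define d where "d = length ms'"
  define as where "as = map (\<lambda>i. 2 * i) [0..<e] @ map (\<lambda>i. 2 * i + 1) [0..<d]"
  \<comment> \<open>The subtraction is exact: both alternatives of \<open>ed\<close> below give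
    \<open>k \<le> e + d\<close>.\<close>
  define core where "core = staircase k @ replicate (e + d - k) 0"
  have dist: "distinct ns" unfolding ns_def by (rule distinct_degvec[OF sorted])
  have ns': "ns' = filter even ns @ filter odd ns"
    unfolding ns'_def ms_def ms'_def map_map o_def by (auto intro!: map_idI)
  then have mset: "mset ns' = mset ns" by simp
  have dist': "distinct ns'" and set': "set ns' = set ns"
    using mset_eq_imp_distinct_iff[OF mset] mset_eq_setD[OF mset] dist by simp_all
  then have dist_ms: "distinct ms" "distinct ms'"
    unfolding ns'_def by (simp_all add: distinct_map)
  have len: "length ns' = e + d" "length lam = e + d"
    using mset_eq_length[OF mset] by (simp_all add: ns'_def e_def d_def ns_def)
  have counts: "card {n \<in> set (degvec lam). even n} = e" "card {n \<in> set (degvec lam). odd n} = d"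
    using dist unfolding ns_def e_def d_def ms_def ms'_def
    by (simp_all flip: set_filter add: distinct_card)
  have ed: "d = e + k \<or> e = d + k + 1" and sum_lam: "sum_list lam = ?c + 2 * ?m"
    using Phi_degrees[OF assms] unfolding counts sum_list_staircase by simp_all
  have core: "sorted_wrt (\<ge>) core" "length core = length lam" "sum_list core = ?c"
    "hook_prod_odd core = hook_prod (staircase k)"
    unfolding core_def len using ed
    by (auto simp: sorted_staircase_zeros sum_list_replicate hook_prod_odd_append_zeros
        hook_prod_staircase)
  have set_core: "set (degvec core) = set as"
    unfolding core_def as_def by (rule set_degvec_staircase_zeros[OF ed])
  \<comment> \<open>\<open>as\<close> lists the degrees of the padded core, so beyond the size of
    the core its sum is just the exponent by which the rows were multiplied. That power of
    \<open>x\<close> cancels.\<close>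
  have sum_as: "sum_list as = ?c + (\<Sum>i<e + d. i)"
  proof -
    have "distinct as" unfolding as_def by (auto simp: distinct_map inj_on_def) presburger+
    then have "sum_list as = sum_list (degvec core)"
      using sum_list_distinct_conv_sum_set[OF distinct_degvec[OF core(1)], of "\<lambda>x. x"]
        sum_list_distinct_conv_sum_set[of as "\<lambda>x. x"] set_core by simp
    then show ?thesis using core len by (simp add: sum_degvec)
  qed
  obtain Q where Q: "monom 1 (\<Sum>i<e + d. i) * Wronskian (map Herm ns') =
      monom 1 (sum_list as) * pcompose Q ?X"
    and Q_eq: "poly Q 0 = ?V as *
      ((\<Prod>j<e. herm_weight (2 * ms ! j) / (herm_weight (2 * j) * fact j)) * ?V ms) *
      ((\<Prod>j<d. herm_weight (2 * ms' ! j + 1) / (herm_weight (2 * j + 1) * fact j)) * ?V ms')"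
    using Wronskian_Herm_lowest_term[OF dist_ms] unfolding e_def d_def as_def ns'_def by blast
  have Q0: "poly Q 0 / ?V ns' = parity_ratio (set ns') / parity_ratio (set as)"
    unfolding Q_eq unfolding e_def d_def as_def ns'_def
    by (rule Wronskian_value_eq_parity_ratio[OF dist_ms])
  have V: "?V ns \<noteq> 0" "?V ns' \<noteq> 0" using Vandermonde_Delta_nonzero dist dist' by simp_all
  define R where "R = smult (1 / ?V ns') Q"
  have "monom 1 (\<Sum>i<e + d. i) * Wronskian (map Herm ns') =
      monom 1 (\<Sum>i<e + d. i) * (monom 1 ?c * pcompose Q ?X)"
    unfolding Q sum_as by (simp add: mult_monom add.commute flip: mult.assoc)
  then have W: "Wronskian (map Herm ns') = monom 1 ?c * pcompose Q ?X"
    by (simp add: monom_eq_0_iff)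
  \<comment> \<open>For the empty list the Wronskian and the Vandermonde product are both
    \<open>1\<close>, so the separate clause of \<open>WHermite\<close> agrees.\<close>
  have "WHermite lam = smult (1 / ?V ns) (Wronskian (map Herm ns))"
    by (simp add: WHermite_def ns_def degvec_def Wronskian_def leibniz_det_def Vandermonde_Delta_def)
  also have "\<dots> = smult (1 / ?V ns') (Wronskian (map Herm ns'))"
  proof -
    have "smult (1 / (?V ns * ?V ns')) (smult (?V ns') (Wronskian (map Herm ns))) =
        smult (1 / (?V ns * ?V ns')) (smult (?V ns) (Wronskian (map Herm ns')))"
      using Wronskian_Vandermonde_permute[OF mset[symmetric], of Herm] by simp
    then show ?thesis using V by simp
  qed
  also have "\<dots> = monom 1 ?c * pcompose R ?X"
    by (simp add: W R_def pcompose_smult)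
  finally have WH: "WHermite lam = monom 1 ?c * pcompose R ?X" .
  have sum_ns': "sum_list ns' = (\<Sum>i<e + d. i) + (?c + 2 * ?m)"
  proof -
    have "sum_list ns' = sum_list ns" using mset by (metis sum_mset_sum_list)
    then show ?thesis by (simp add: ns_def sum_degvec sum_lam len)
  qed
  \<comment> \<open>In these exponents the top degree \<open>sum_list ns'\<close> corresponds to
    \<open>i = ?m\<close>, which turns the highest term into the leading coefficient of
    \<open>Q\<close>.\<close>
  have coeff_Q: "coeff (monom 1 (\<Sum>i<e + d. i) * Wronskian (map Herm ns'))
      ((\<Sum>i<e + d. i) + (?c + 2 * i)) = coeff Q i" for i
    unfolding W by (simp add: Polynomial.coeff_monom_mult coeff_pcompose_square)
  have "coeff Q ?m = ?V ns'"
    using Wronskian_Herm_top_term(1)[of ns'] unfolding len sum_ns' coeff_Q .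
  moreover have "coeff Q i = 0" if "?m < i" for i
    unfolding coeff_Q[symmetric]
    by (rule coeff_eq_0, rule le_less_trans[OF Wronskian_Herm_top_term(2)[of ns', unfolded len]])
      (use that in \<open>simp add: sum_ns'\<close>)
  ultimately have R: "coeff R ?m = 1" "degree R \<le> ?m"
    using V(2) by (auto simp: R_def intro!: degree_le)
  then have deg: "degree R = ?m" by (metis le_antisym le_degree zero_neq_one)
  have R0: "poly R 0 = parity_ratio (set (degvec lam)) / parity_ratio (set (degvec core))"
    using Q0 unfolding R_def set' set_core ns_def by simp
  have quotient: "poly R 0 = (-1) ^ (v + ?m) * real (hook_prod_odd lam) / real (hook_prod (staircase k))"
    if "even (v + (\<Sum>i<length lam. i * lam ! i) + (\<Sum>i<length core. i * core ! i))" for v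
    unfolding R0 core(4)[symmetric]
  proof (rule parity_ratio_quotient[OF sorted core(1,2) _ _ that])
    show "card {a \<in> set (degvec lam). odd a} = card {a \<in> set (degvec core). odd a}"
    proof -
      have "{a \<in> set as. odd a} = (\<lambda>i. 2 * i + 1) ` {..<d}" by (auto simp: as_def)
      then show ?thesis
        unfolding counts set_core by (simp add: card_image inj_on_def)
    qed
    show "sum_list lam = sum_list core + 2 * ?m" by (simp add: sum_lam core)
  qed
  have core_rows: "(\<Sum>i<length core. i * core ! i) =
      (\<Sum>i<length (staircase k). i * staircase k ! i)"
    unfolding sum_row_young[symmetric] core_def young_append_zeros by (rule HOL.refl)
  have "poly R 0 = (-1) ^ (v + (sum_list lam - ?c) div 2) *
      real (hook_prod_odd lam) / real (hook_prod (staircase k))"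
    if "domino_seq lam (staircase k) v" for v
    using quotient[of v] domino_seq_parity[OF that] by (simp add: core_rows sum_lam)
  \<comment> \<open>Both parity ratios are a sign times a product of odd, hence positive, hook
    lengths; no domino sequence has to exist for this.\<close>
  moreover have "poly R 0 \<noteq> 0"
  proof -
    have "parity_ratio (set (degvec xs)) \<noteq> 0" if "sorted_wrt (\<ge>) xs" for xs
      unfolding parity_ratio_degvec[OF that] hook_prod_odd_def
      using finite_young[of xs] by (auto simp: odd_pos)
    then show ?thesis unfolding R0 using sorted core(1) by simp
  qed
  ultimately show ?thesis
    using WH R(1) deg by (intro exI[of _ R]) auto
qed

end
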